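(* Let $G$ be a Lie group with Lie algebra $\mathfrak{g}$ and a left representation $G\times V\to V$, $(g,I)\mapsto gI$, on a vector space $V$ whose norm $\|\cdot\|_V$ is induced by an inner product. Let $\ell:2\mathfrak{g}\to\mathbb{R}$ be a Lagrangian, $\sigma\in\mathbb{R}\setminus\{0\}$, $h>0$, integers $0=N_0<N_1<\dots<N_l=N$, target times $t_i=N_ih$, $T_0,I_{t_1},\dots,I_{t_l}\in V$, $\xi_0^0\in\mathfrak{g}$, Runge--Kutta coefficients $(a_{ij})_{i,j=1}^s$, $(b_i)_{i=1}^s$, and a local approximation $\tau:\mathfrak{g}\to G$ of the exponential map be given. Let $\gamma\in\mathcal{C}_d$ with $g_0=e$, $\xi_0=\xi_0^0$ be a critical point, with respect to variations with $\delta g_0=0$ and $\delta\xi_0=0$, of the discrete trajectory-planning functional \begin{align*}S=h\sum_{k=0}^{N-1}\Big\{&\sum_{i=1}^s\Big[b_i\ell(\Xi_k^i,V_k^i)+\Big\langle\mu_k^i,\tfrac1h\tau^{-1}(g_k^{-1}G_k^i)-\sum_{j}a_{ij}\Xi_k^j\Big\rangle+\Big\langle\nu_k^i,\tfrac1h(\Xi_k^i-\xi_k)-\sum_{j}a_{ij}V_k^j\Big\rangle\Big]\\&+\Big\langle\check\mu_{k+1},\tfrac1h\tau^{-1}(g_k^{-1}g_{k+1})-\sum_{i}b_i\Xi_k^i\Big\rangle+\Big\langle\nu_{k+1},\tfrac1h(\xi_{k+1}-\xi_k)-\sum_{i}b_iV_k^i\Big\rangle\Big\}+\frac{1}{2\sigma^2}\sum_{i=1}^l\|g_{N_i}^{-1}T_0-I_{t_i}\|_V^2.\end{align*}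 Then the discrete momentum $\mathbf{J}_k:=\operatorname{Ad}^*_{g_k^{-1}}\mu_k$ satisfies $$\mathbf{J}_{k+1}=\mathbf{J}_k\quad\text{for all interior indices }k\in\{1,\dots,N-1\}\setminus\{N_1,\dots,N_{l-1}\},$$ and, for $i=1,\dots,l-1$, $$\mathbf{J}_{N_i+1}-\mathbf{J}_{N_i}=-\frac{1}{\sigma^2}\operatorname{Ad}^*_{g_{N_i}^{-1}}\Big(\big(g_{N_i}^{-1}T_0\big)\diamond\big(g_{N_i}^{-1}T_0-I_{t_i}\big)^\flat\Big).$$
   Context: $2\mathfrak{g}=\mathfrak{g}\times\mathfrak{g}$, $\ell=\ell(\xi,u)$ smooth. The discrete path space is $\mathcal{C}_d=(G\times\mathfrak{g})\times(G\times\mathfrak{g}\times2\mathfrak{g}^* )^N\times(G\times2\mathfrak{g}\times2\mathfrak{g}^* )^{Ns}$ with elements $$\gamma=\big\{(g_0,\xi_0),(g_k,\xi_k,\check\mu_k,\nu_k)_{k=1}^N,(G_k^i,\Xi_k^i,V_k^i,\mu_k^i,\nu_k^i)_{1\le i\le s,\,0\le k\le N-1}\big\}.$$ The map $\tau$ is an analytic diffeomorphism from a neighbourhood of $0\in\mathfrak{g}$ onto a neighbourhood of $e\in G$, with $\tau(0)=e$, $\tau(-\eta)\tau(\eta)=e$; its right-trivialised differential is $d\tau_\xi(\eta)=(T_\xi\tau(\eta))\tau(\xi)^{-1}$, with inverse $d\tau_\xi^{-1}$. All arguments of $\tau,\tau^{-1}$ are assumed to lie in these neighbourhoods. Notation: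 $\Xi_{k+1}=\sum_jb_j\Xi_k^j$ for $k=0,\dots,N-1$ and $\mu_k=(d\tau^{-1}_{-h\Xi_k})^*\check\mu_k$ for $k=1,\dots,N$. $\operatorname{Ad}^*_g$ denotes the dual map of $\operatorname{Ad}_g$. $\flat:V\to V^*$ is defined by $\langle u,v\rangle_V=\langle u^\flat,v\rangle$, and $\diamond:V\times V^*\to\mathfrak{g}^*$ is the cotangent-lift momentum map $\langle I\diamond\omega,\xi\rangle=\langle\omega,\xi_V(I)\rangle$ for all $I\in V$, $\omega\in V^*$, $\xi\in\mathfrak{g}$, where $\xi_V(I)=\frac{d}{d\varepsilon}|_{\varepsilon=0}\exp(\varepsilon\xi)I$. *)

theory Defs
  imports "HOL-Analysis.Analysis"
begin

section \<open>Smooth and real-analytic maps on open sets\<close>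

text \<open>Iterated directional derivatives are used because the derivative as an operator-valued map
  changes its type at each order. On finite-dimensional domains this is the usual \<open>C\<^sup>n\<close>. The set
  \<open>S\<close> is meant to be open, here and in all definitions of this section.\<close>

fun k_smooth_on :: "nat \<Rightarrow> 'a::real_normed_vector set \<Rightarrow> ('a \<Rightarrow> 'b::real_normed_vector) \<Rightarrow> bool" where
  "k_smooth_on 0 S f \<longleftrightarrow> continuous_on S f"
| "k_smooth_on (Suc n) S f \<longleftrightarrow>
     (\<forall>x\<in>S. f differentiable (at x)) \<and>
     (\<forall>v. k_smooth_on n S (\<lambda>x. frechet_derivative f (at x) v))"

definition smooth_on :: "'a::real_normed_vector set \<Rightarrow> ('a \<Rightarrow> 'b::real_normed_vector) \<Rightarrow> bool" where
  "smooth_on S f \<longleftrightarrow> (\<forall>n. k_smooth_on n S f)"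

text \<open>A smooth map that is locally the sum of a power series; the sum runs over multi-indices
  \<open>\<alpha>\<close>, i.e. functions from the basis to the naturals, extended by \<open>0\<close>. Smoothness already
  follows from the convergence and is included only for convenience.\<close>

definition real_analytic_on :: "'a::euclidean_space set \<Rightarrow> ('a \<Rightarrow> 'b::real_normed_vector) \<Rightarrow> bool" where
  "real_analytic_on S f \<longleftrightarrow> smooth_on S f \<and>
     (\<forall>x\<in>S. \<exists>r>0. \<exists>c :: ('a \<Rightarrow> nat) \<Rightarrow> 'b. ball x r \<subseteq> S \<and>
        (\<forall>y\<in>ball x r.
           ((\<lambda>\<alpha>. (\<Prod>b\<in>Basis. ((y - x) \<bullet> b) ^ \<alpha> b) *\<^sub>R c \<alpha>) has_sum f y)
             {\<alpha>. \<forall>b. b \<notin> Basis \<longrightarrow> \<alpha> b = 0}))"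


section \<open>Atlases and maps between manifolds\<close>

type_synonym ('g, 'e) chart = "'g set \<times> ('g \<Rightarrow> 'e)"

definition analytic_atlas ::
  "('g::topological_space, 'e::euclidean_space) chart set \<Rightarrow> bool" where
  "analytic_atlas A \<longleftrightarrow>
     (\<Union>(U, \<phi>)\<in>A. U) = UNIV \<and>
     (\<forall>(U, \<phi>)\<in>A. open U \<and> open (\<phi> ` U) \<and> homeomorphism U (\<phi> ` U) \<phi> (inv_into U \<phi>)) \<and>
     (\<forall>(U, \<phi>)\<in>A. \<forall>(W, \<psi>)\<in>A. real_analytic_on (\<phi> ` (U \<inter> W)) (\<psi> \<circ> inv_into U \<phi>))"

definition vector_atlas :: "('a::real_normed_vector, 'a) chart set" where
  "vector_atlas = {(UNIV, id)}"

definition prod_atlas :: "('a, 'c) chart set \<Rightarrow> ('b, 'd) chart set \<Rightarrow> ('a \<times> 'b, 'c \<times> 'd) chart set" where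
  "prod_atlas A B = {(U \<times> W, map_prod \<phi> \<psi>) | U \<phi> W \<psi>. (U, \<phi>) \<in> A \<and> (W, \<psi>) \<in> B}"

text \<open>A map on an open subset \<open>X\<close> that is continuous and satisfies \<open>R\<close> in all charts.\<close>

definition regular_map_on ::
  "('c set \<Rightarrow> ('c \<Rightarrow> 'd) \<Rightarrow> bool) \<Rightarrow> 'a::topological_space set \<Rightarrow>
   ('a, 'c) chart set \<Rightarrow> ('b::topological_space, 'd) chart set \<Rightarrow> ('a \<Rightarrow> 'b) \<Rightarrow> bool" where
  "regular_map_on R X A B f \<longleftrightarrow> open X \<and> continuous_on X f \<and>
     (\<forall>(U, \<phi>)\<in>A. \<forall>(W, \<psi>)\<in>B. R (\<phi> ` (U \<inter> X \<inter> f -` W)) (\<psi> \<circ> f \<circ> inv_into U \<phi>))"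

abbreviation smooth_map_on where "smooth_map_on \<equiv> regular_map_on smooth_on"

abbreviation analytic_map_on where "analytic_map_on \<equiv> regular_map_on real_analytic_on"

definition analytic_diffeo ::
  "'a::topological_space set \<Rightarrow> 'b::topological_space set \<Rightarrow>
   ('a, 'c::euclidean_space) chart set \<Rightarrow> ('b, 'd::euclidean_space) chart set \<Rightarrow> ('a \<Rightarrow> 'b) \<Rightarrow> bool" where
  "analytic_diffeo X Y A B f \<longleftrightarrow>
     bij_betw f X Y \<and> analytic_map_on X A B f \<and> analytic_map_on Y B A (inv_into X f)"


section \<open>Lie groups\<close>

text \<open>The field \<open>id_chart\<close> is an arbitrary chart around the identity. Its differential identifies
  the Lie algebra, i.e. the tangent space at the identity, with the model space \<open>'e\<close>. The smooth
  structure of a Lie group contains a unique analytic one for which the group operations are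
  analytic; the atlas is one of this analytic structure, because analytic maps into the group
  have to be considered.\<close>

record ('g, 'e) lie_data =
  gmul :: "'g \<Rightarrow> 'g \<Rightarrow> 'g"
  gone :: "'g"
  ginv :: "'g \<Rightarrow> 'g"
  gatlas :: "('g, 'e) chart set"
  id_chart :: "('g, 'e) chart"

definition lie_group ::
  "('g::{t2_space, second_countable_topology}, 'e::euclidean_space) lie_data \<Rightarrow> bool" where
  "lie_group L \<longleftrightarrow>
     group (gmul L) (gone L) (ginv L) \<and>
     analytic_atlas (gatlas L) \<and>
     analytic_map_on UNIV (prod_atlas (gatlas L) (gatlas L)) (gatlas L) (\<lambda>(x, y). gmul L x y) \<and>
     analytic_map_on UNIV (gatlas L) (gatlas L) (ginv L) \<and>
     id_chart L \<in> gatlas L \<and> gone L \<in> fst (id_chart L)"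

definition id_coord :: "('g, 'e) lie_data \<Rightarrow> 'g \<Rightarrow> 'e" where
  "id_coord L = snd (id_chart L)"

definition id_point :: "('g, 'e) lie_data \<Rightarrow> 'e \<Rightarrow> 'g" where
  "id_point L = inv_into (fst (id_chart L)) (snd (id_chart L))"

text \<open>The left-trivialised velocity at time \<open>0\<close> of a curve \<open>c\<close> in the group, i.e. the tangent vector
  \<open>c(0)\<^sup>-\<^sup>1c'(0)\<close> at the identity.\<close>

definition has_left_velocity ::
  "('g, 'e::real_normed_vector) lie_data \<Rightarrow> (real \<Rightarrow> 'g) \<Rightarrow> 'e \<Rightarrow> bool" where
  "has_left_velocity L c \<xi> \<longleftrightarrow>
     ((\<lambda>t. id_coord L (gmul L (ginv L (c 0)) (c t))) has_vector_derivative \<xi>) (at 0)"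

definition one_param_subgroup ::
  "('g::topological_space, 'e::real_normed_vector) lie_data \<Rightarrow> 'e \<Rightarrow> (real \<Rightarrow> 'g) \<Rightarrow> bool" where
  "one_param_subgroup L \<xi> c \<longleftrightarrow>
     smooth_map_on UNIV vector_atlas (gatlas L) c \<and>
     (\<forall>s t. c (s + t) = gmul L (c s) (c t)) \<and>
     has_left_velocity L c \<xi>"

definition lie_exp :: "('g::topological_space, 'e::real_normed_vector) lie_data \<Rightarrow> 'e \<Rightarrow> 'g" where
  "lie_exp L \<xi> = (THE c. one_param_subgroup L \<xi> c) 1"

definition Ad :: "('g, 'e::real_normed_vector) lie_data \<Rightarrow> 'g \<Rightarrow> 'e \<Rightarrow> 'e" where
  "Ad L g = frechet_derivative
     (\<lambda>x. id_coord L (gmul L (gmul L g (id_point L x)) (ginv L g))) (at (id_coord L (gone L)))"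

definition dual_map ::
  "('a::real_normed_vector \<Rightarrow> 'b::real_normed_vector) \<Rightarrow> ('b \<Rightarrow>\<^sub>L real) \<Rightarrow> ('a \<Rightarrow>\<^sub>L real)" where
  "dual_map T \<mu> = Blinfun (\<lambda>v. blinfun_apply \<mu> (T v))"

definition Ad_star ::
  "('g, 'e::real_normed_vector) lie_data \<Rightarrow> 'g \<Rightarrow> ('e \<Rightarrow>\<^sub>L real) \<Rightarrow> ('e \<Rightarrow>\<^sub>L real)" where
  "Ad_star L g = dual_map (Ad L g)"


section \<open>Representations and the cotangent-lift momentum map\<close>

definition left_representation ::
  "('g::topological_space, 'e::real_normed_vector) lie_data \<Rightarrow>
   ('g \<Rightarrow> 'v::real_inner \<Rightarrow> 'v) \<Rightarrow> bool" where
  "left_representation L act \<longleftrightarrow>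
     (\<forall>I. act (gone L) I = I) \<and>
     (\<forall>g h I. act (gmul L g h) I = act g (act h I)) \<and>
     (\<forall>g. linear (act g)) \<and>
     smooth_map_on UNIV (prod_atlas (gatlas L) vector_atlas) vector_atlas (\<lambda>(g, I). act g I)"

definition inf_generator ::
  "('g::topological_space, 'e::real_normed_vector) lie_data \<Rightarrow>
   ('g \<Rightarrow> 'v::real_inner \<Rightarrow> 'v) \<Rightarrow> 'e \<Rightarrow> 'v \<Rightarrow> 'v" where
  "inf_generator L act \<xi> I = vector_derivative (\<lambda>\<epsilon>. act (lie_exp L (\<epsilon> *\<^sub>R \<xi>)) I) (at 0)"

definition flat :: "'v::real_inner \<Rightarrow> ('v \<Rightarrow>\<^sub>L real)" where
  "flat u = Blinfun (\<lambda>v. u \<bullet> v)"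

definition diamond ::
  "('g::topological_space, 'e::real_normed_vector) lie_data \<Rightarrow>
   ('g \<Rightarrow> 'v::real_inner \<Rightarrow> 'v) \<Rightarrow> 'v \<Rightarrow> ('v \<Rightarrow>\<^sub>L real) \<Rightarrow> ('e \<Rightarrow>\<^sub>L real)" where
  "diamond L act I \<omega> = Blinfun (\<lambda>\<xi>. blinfun_apply \<omega> (inf_generator L act \<xi> I))"


section \<open>The local approximation of the exponential map\<close>

text \<open>The set \<open>D\<close> is the neighbourhood of \<open>0\<close> on which \<open>\<tau>\<close> is a diffeomorphism onto its image; the
  inverse of \<open>\<tau>\<close> is always \<open>inv_into D \<tau>\<close>.\<close>

definition exp_approx ::
  "('g::{t2_space, second_countable_topology}, 'e::euclidean_space) lie_data \<Rightarrow>
   'e set \<Rightarrow> ('e \<Rightarrow> 'g) \<Rightarrow> bool" where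
  "exp_approx L D \<tau> \<longleftrightarrow>
     open D \<and> 0 \<in> D \<and> open (\<tau> ` D) \<and>
     analytic_diffeo D (\<tau> ` D) vector_atlas (gatlas L) \<tau> \<and>
     \<tau> 0 = gone L \<and>
     (\<forall>\<eta>. \<eta> \<in> D \<longrightarrow> - \<eta> \<in> D \<longrightarrow> gmul L (\<tau> (- \<eta>)) (\<tau> \<eta>) = gone L)"

text \<open>The right-trivialised differential \<open>\<eta> \<mapsto> (T\<^sub>\<xi>\<tau>(\<eta>))\<tau>(\<xi>)\<^sup>-\<^sup>1\<close>; the right translation is
  applied before differentiating so that the derivative can be read off in the chart around the
  identity.\<close>

definition dtau :: "('g, 'e::real_normed_vector) lie_data \<Rightarrow> ('e \<Rightarrow> 'g) \<Rightarrow> 'e \<Rightarrow> 'e \<Rightarrow> 'e" where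
  "dtau L \<tau> \<xi> = frechet_derivative (\<lambda>\<zeta>. id_coord L (gmul L (\<tau> \<zeta>) (ginv L (\<tau> \<xi>)))) (at \<xi>)"

definition dtau_inv :: "('g, 'e::real_normed_vector) lie_data \<Rightarrow> ('e \<Rightarrow> 'g) \<Rightarrow> 'e \<Rightarrow> 'e \<Rightarrow> 'e" where
  "dtau_inv L \<tau> \<xi> = inv (dtau L \<tau> \<xi>)"


section \<open>The discrete path space and the discrete functional\<close>

text \<open>For parameters \<open>N\<close> and \<open>s\<close>, the components that belong to the path are \<open>pt_g k\<close> and
  \<open>pt_xi k\<close> for \<open>0 \<le> k \<le> N\<close>, \<open>pt_mu k\<close> (the multiplier with a check) and \<open>pt_nu k\<close> for
  \<open>1 \<le> k \<le> N\<close>, and the stage components \<open>st_\<dots> k i\<close> for \<open>0 \<le> k \<le> N - 1\<close> and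
  \<open>1 \<le> i \<le> s\<close>. Values at other indices are irrelevant.\<close>

record (overloaded) ('g, 'e::real_normed_vector) discrete_path =
  pt_g :: "nat \<Rightarrow> 'g"
  pt_xi :: "nat \<Rightarrow> 'e"
  pt_mu :: "nat \<Rightarrow> 'e \<Rightarrow>\<^sub>L real"
  pt_nu :: "nat \<Rightarrow> 'e \<Rightarrow>\<^sub>L real"
  st_G :: "nat \<Rightarrow> nat \<Rightarrow> 'g"
  st_Xi :: "nat \<Rightarrow> nat \<Rightarrow> 'e"
  st_V :: "nat \<Rightarrow> nat \<Rightarrow> 'e"
  st_mu :: "nat \<Rightarrow> nat \<Rightarrow> 'e \<Rightarrow>\<^sub>L real"
  st_nu :: "nat \<Rightarrow> nat \<Rightarrow> 'e \<Rightarrow>\<^sub>L real"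

text \<open>\<open>avg_Xi b s \<gamma> k\<close> is the weighted average belonging to the index \<open>k \<ge> 1\<close>, formed from the
  stages of step \<open>k - 1\<close>.\<close>

definition avg_Xi ::
  "(nat \<Rightarrow> real) \<Rightarrow> nat \<Rightarrow> ('g, 'e::real_normed_vector) discrete_path \<Rightarrow> nat \<Rightarrow> 'e" where
  "avg_Xi b s \<gamma> k = (\<Sum>j = 1..s. b j *\<^sub>R st_Xi \<gamma> (k - 1) j)"

definition in_domain ::
  "('g, 'e::real_normed_vector) lie_data \<Rightarrow> 'e set \<Rightarrow> ('e \<Rightarrow> 'g) \<Rightarrow> (nat \<Rightarrow> real) \<Rightarrow>
   real \<Rightarrow> nat \<Rightarrow> nat \<Rightarrow> ('g, 'e) discrete_path \<Rightarrow> bool" where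
  "in_domain L D \<tau> b h N s \<gamma> \<longleftrightarrow>
     (\<forall>k<N. gmul L (ginv L (pt_g \<gamma> k)) (pt_g \<gamma> (Suc k)) \<in> \<tau> ` D) \<and>
     (\<forall>k<N. \<forall>i\<in>{1..s}. gmul L (ginv L (pt_g \<gamma> k)) (st_G \<gamma> k i) \<in> \<tau> ` D) \<and>
     (\<forall>k\<in>{1..N}. - (h *\<^sub>R avg_Xi b s \<gamma> k) \<in> D)"

definition discrete_functional ::
  "('g, 'e::real_normed_vector) lie_data \<Rightarrow> ('g \<Rightarrow> 'v::real_inner \<Rightarrow> 'v) \<Rightarrow>
   ('e \<times> 'e \<Rightarrow> real) \<Rightarrow> 'e set \<Rightarrow> ('e \<Rightarrow> 'g) \<Rightarrow>
   (nat \<Rightarrow> nat \<Rightarrow> real) \<Rightarrow> (nat \<Rightarrow> real) \<Rightarrow> real \<Rightarrow> real \<Rightarrow> nat \<Rightarrow> nat \<Rightarrow>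
   nat \<Rightarrow> (nat \<Rightarrow> nat) \<Rightarrow> (nat \<Rightarrow> real) \<Rightarrow> 'v \<Rightarrow> (real \<Rightarrow> 'v) \<Rightarrow>
   ('g, 'e) discrete_path \<Rightarrow> real" where
  "discrete_functional L act lag D \<tau> a b h \<sigma> N s l Nt t T0 I \<gamma> =
     h * (\<Sum>k<N.
       (\<Sum>i = 1..s.
          b i * lag (st_Xi \<gamma> k i, st_V \<gamma> k i)
          + blinfun_apply (st_mu \<gamma> k i)
              ((1 / h) *\<^sub>R inv_into D \<tau> (gmul L (ginv L (pt_g \<gamma> k)) (st_G \<gamma> k i))
                - (\<Sum>j = 1..s. a i j *\<^sub>R st_Xi \<gamma> k j))
          + blinfun_apply (st_nu \<gamma> k i)
              ((1 / h) *\<^sub>R (st_Xi \<gamma> k i - pt_xi \<gamma> k)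
                - (\<Sum>j = 1..s. a i j *\<^sub>R st_V \<gamma> k j)))
       + blinfun_apply (pt_mu \<gamma> (k + 1))
           ((1 / h) *\<^sub>R inv_into D \<tau> (gmul L (ginv L (pt_g \<gamma> k)) (pt_g \<gamma> (k + 1)))
             - (\<Sum>i = 1..s. b i *\<^sub>R st_Xi \<gamma> k i))
       + blinfun_apply (pt_nu \<gamma> (k + 1))
           ((1 / h) *\<^sub>R (pt_xi \<gamma> (k + 1) - pt_xi \<gamma> k)
             - (\<Sum>i = 1..s. b i *\<^sub>R st_V \<gamma> k i)))
     + 1 / (2 * \<sigma>\<^sup>2) * (\<Sum>i = 1..l. (norm (act (ginv L (pt_g \<gamma> (Nt i))) T0 - I (t i)))\<^sup>2)"

definition smooth_path_variation ::
  "('g::topological_space, 'e::real_normed_vector) lie_data \<Rightarrow> nat \<Rightarrow> nat \<Rightarrow>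
   (real \<Rightarrow> ('g, 'e) discrete_path) \<Rightarrow> bool" where
  "smooth_path_variation L N s \<Gamma> \<longleftrightarrow>
     (\<forall>k\<in>{0..N}. smooth_map_on UNIV vector_atlas (gatlas L) (\<lambda>\<epsilon>. pt_g (\<Gamma> \<epsilon>) k)
                 \<and> smooth_on UNIV (\<lambda>\<epsilon>. pt_xi (\<Gamma> \<epsilon>) k)) \<and>
     (\<forall>k\<in>{1..N}. smooth_on UNIV (\<lambda>\<epsilon>. pt_mu (\<Gamma> \<epsilon>) k)
                 \<and> smooth_on UNIV (\<lambda>\<epsilon>. pt_nu (\<Gamma> \<epsilon>) k)) \<and>
     (\<forall>k<N. \<forall>i\<in>{1..s}.
        smooth_map_on UNIV vector_atlas (gatlas L) (\<lambda>\<epsilon>. st_G (\<Gamma> \<epsilon>) k i)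
        \<and> smooth_on UNIV (\<lambda>\<epsilon>. st_Xi (\<Gamma> \<epsilon>) k i)
        \<and> smooth_on UNIV (\<lambda>\<epsilon>. st_V (\<Gamma> \<epsilon>) k i)
        \<and> smooth_on UNIV (\<lambda>\<epsilon>. st_mu (\<Gamma> \<epsilon>) k i)
        \<and> smooth_on UNIV (\<lambda>\<epsilon>. st_nu (\<Gamma> \<epsilon>) k i))"

text \<open>Critical with respect to all variations with \<open>\<delta>g\<^sub>0 = 0\<close> and \<open>\<delta>\<xi>\<^sub>0 = 0\<close>.\<close>

definition critical_path ::
  "('g::topological_space, 'e::real_normed_vector) lie_data \<Rightarrow> nat \<Rightarrow> nat \<Rightarrow>
   (('g, 'e) discrete_path \<Rightarrow> real) \<Rightarrow> ('g, 'e) discrete_path \<Rightarrow> bool" where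
  "critical_path L N s S \<gamma> \<longleftrightarrow>
     (\<forall>\<Gamma>. smooth_path_variation L N s \<Gamma> \<and> \<Gamma> 0 = \<gamma> \<and>
          has_left_velocity L (\<lambda>\<epsilon>. pt_g (\<Gamma> \<epsilon>) 0) 0 \<and>
          ((\<lambda>\<epsilon>. pt_xi (\<Gamma> \<epsilon>) 0) has_vector_derivative 0) (at 0)
        \<longrightarrow> ((\<lambda>\<epsilon>. S (\<Gamma> \<epsilon>)) has_real_derivative 0) (at 0))"

definition discrete_mu ::
  "('g, 'e::real_normed_vector) lie_data \<Rightarrow> ('e \<Rightarrow> 'g) \<Rightarrow> (nat \<Rightarrow> real) \<Rightarrow> real \<Rightarrow> nat \<Rightarrow>
   ('g, 'e) discrete_path \<Rightarrow> nat \<Rightarrow> ('e \<Rightarrow>\<^sub>L real)" where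
  "discrete_mu L \<tau> b h s \<gamma> k =
     dual_map (dtau_inv L \<tau> (- (h *\<^sub>R avg_Xi b s \<gamma> k))) (pt_mu \<gamma> k)"

definition discrete_momentum ::
  "('g, 'e::real_normed_vector) lie_data \<Rightarrow> ('e \<Rightarrow> 'g) \<Rightarrow> (nat \<Rightarrow> real) \<Rightarrow> real \<Rightarrow> nat \<Rightarrow>
   ('g, 'e) discrete_path \<Rightarrow> nat \<Rightarrow> ('e \<Rightarrow>\<^sub>L real)" where
  "discrete_momentum L \<tau> b h s \<gamma> k = Ad_star L (ginv L (pt_g \<gamma> k)) (discrete_mu L \<tau> b h s \<gamma> k)"

end

theory Submission
  imports Defs
begin

text \<open>Vary \<open>g\<^sub>m\<close> to \<open>c(\<epsilon>) g\<^sub>m\<close> and the stages \<open>G\<^sub>m\<^sup>i\<close> to \<open>c(\<epsilon>) G\<^sub>m\<^sup>i\<close> for a one-parameter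
  subgroup \<open>c\<close> with velocity \<open>\<zeta>\<close>. The products \<open>g\<^sub>m\<^sup>-\<^sup>1 G\<^sub>m\<^sup>i\<close> do not change, and the two increments
  that contain \<open>g\<^sub>m\<close> are multiplied on the right by conjugates of \<open>c(\<plusminus>\<epsilon>)\<close>. Since the multiplier
  equations force \<open>g\<^sub>k\<^sup>-\<^sup>1 g\<^sub>k\<^sub>+\<^sub>1 = \<tau>(h \<Xi>\<^sub>k\<^sub>+\<^sub>1)\<close>, these increments contribute
  \<open>\<langle>J\<^sub>m, \<zeta>\<rangle> - \<langle>J\<^sub>m\<^sub>+\<^sub>1, \<zeta>\<rangle>\<close> to the derivative of the functional, and a target term at \<open>g\<^sub>m\<close>
  contributes the infinitesimal generator of \<open>Ad(g\<^sub>m\<^sup>-\<^sup>1) \<zeta>\<close>. One-parameter subgroups, on which the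
  infinitesimal generators depend, are integral curves of left-invariant vector fields: these
  exist near \<open>0\<close> by Picard's theorem, are local homomorphisms by uniqueness, and are extended by
  \<open>c(t) = c(t/n)\<^sup>n\<close>.\<close>

section \<open>Calculus of smooth maps on open sets\<close>

text \<open>Left translation of one g_m keeps both increments in the form \<tau>(\<eta>) times a
  conjugate of c: g_{m-1}^{-1} c g_m gives conjugation by g_m^{-1}, and g_m^{-1} c(-\<epsilon>)
  g_{m+1} gives conjugation by g_{m+1}^{-1}. So each increment produces Ad at the index of its own
  multiplier, which is how the two momenta arise. Right multiplication of \<tau>(\<eta>) calls for a
  left-trivialised differential at \<eta>; the relation \<tau>(-\<eta>) = \<tau>(\<eta>)^{-1} turns
  it into the right-trivialised one at -\<eta> that occurs in \<mu>. The range 1 \<le> m < N is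
  forced: m \<ge> 1 leaves g_0 fixed, and m < N provides the increment that leaves g_m. The obstacle
  lies before the variation. \<open>lie_exp\<close> is a definite description, and
  \<open>critical_path\<close> tests curves that are smooth on the whole real line, so one-parameter
  subgroups must be shown to exist globally and to be unique, starting from an equation that makes
  sense only in one chart.\<close>

lemma k_smooth_on_subset:
  "k_smooth_on n S f \<Longrightarrow> T \<subseteq> S \<Longrightarrow> k_smooth_on n T f"
  by (induction n arbitrary: f) (auto intro: continuous_on_subset)

lemma k_smooth_on_cong:
  assumes "open S" "\<And>x. x \<in> S \<Longrightarrow> f x = g x" "k_smooth_on n S f"
  shows "k_smooth_on n S g"
  using assms(2,3)
proof (induction n arbitrary: f g)
  case 0
  then show ?case using continuous_on_cong[OF refl, of S f g] by simp
next
  case (Suc n)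
  have "g differentiable at x" if "x \<in> S" for x
  proof -
    have "(f has_derivative frechet_derivative f (at x)) (at x)"
      using Suc.prems(2) that by (simp add: frechet_derivative_works[symmetric])
    from has_derivative_transform_within_open[OF this assms(1) that Suc.prems(1)]
    show ?thesis by (auto simp: differentiable_def)
  qed
  moreover have "frechet_derivative f (at x) v = frechet_derivative g (at x) v" if "x \<in> S" for x v
    by (intro fun_cong[OF frechet_derivative_transform_within_open[OF _ assms(1) that]])
      (use Suc.prems that in simp_all)
  ultimately show ?case
    using Suc.prems(2) by (auto intro: Suc.IH[of "\<lambda>x. frechet_derivative f (at x) _"])
qed

lemma k_smooth_on_local:
  assumes "\<And>x. x \<in> S \<Longrightarrow> \<exists>U. open U \<and> x \<in> U \<and> k_smooth_on n U f"
  shows "k_smooth_on n S f"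
  using assms
proof (induction n arbitrary: f)
  case 0
  have "continuous (at x within S) f" if "x \<in> S" for x
    using 0[OF that] continuous_at_imp_continuous_within continuous_on_eq_continuous_at by fastforce
  then show ?case by (simp add: continuous_on_eq_continuous_within)
next
  case (Suc n)
  have "f differentiable at x" if "x \<in> S" for x using Suc.prems[OF that] by auto
  moreover have "k_smooth_on n S (\<lambda>x. frechet_derivative f (at x) v)" for v
    by (rule Suc.IH) (use Suc.prems in fastforce)
  ultimately show ?case by simp
qed

lemma k_smooth_on_SucD: "k_smooth_on (Suc n) S f \<Longrightarrow> k_smooth_on n S f"
proof (induction n arbitrary: f)
  case 0
  then show ?case
    by (auto intro!: continuous_at_imp_continuous_on differentiable_imp_continuous_within)
next
  case (Suc n)
  then show ?case by simp
qed

lemma k_smooth_on_const [simp]: "k_smooth_on n S (\<lambda>x. c)"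
  by (induction n arbitrary: c) simp_all

text \<open>The recursion refers to the choice operator \<open>frechet_derivative\<close>; here a
  derivative can be exhibited instead. Uniqueness of derivatives makes the two agree on the open
  set.\<close>

lemma k_smooth_on_SucI:
  assumes "open S" "\<And>x. x \<in> S \<Longrightarrow> (f has_derivative f' x) (at x)"
    "\<And>v. k_smooth_on n S (\<lambda>x. f' x v)"
  shows "k_smooth_on (Suc n) S f"
proof -
  have "k_smooth_on n S (\<lambda>x. frechet_derivative f (at x) v)" for v
    by (rule k_smooth_on_cong[OF assms(1) _ assms(3)[of v]])
      (metis assms(2) frechet_derivative_at)
  then show ?thesis using assms(2) by (auto simp: differentiable_def)
qed

lemma k_smooth_on_has_derivative:
  "k_smooth_on (Suc n) S f \<Longrightarrow> x \<in> S \<Longrightarrow> (f has_derivative frechet_derivative f (at x)) (at x)"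
  by (simp add: frechet_derivative_works[symmetric])

lemma k_smooth_on_add:
  assumes "open S" "k_smooth_on n S f" "k_smooth_on n S g"
  shows "k_smooth_on n S (\<lambda>x. f x + g x)"
  using assms(2,3)
proof (induction n arbitrary: f g)
  case 0
  then show ?case by (auto intro: continuous_intros)
next
  case (Suc n)
  show ?case
    by (rule k_smooth_on_SucI[OF assms(1), where f' = "\<lambda>x v. frechet_derivative f (at x) v + frechet_derivative g (at x) v"])
      (use Suc in \<open>auto intro!: has_derivative_add simp: frechet_derivative_works[symmetric]\<close>)
qed

lemma k_smooth_on_sum:
  assumes "open S" "\<And>i. i \<in> A \<Longrightarrow> k_smooth_on n S (f i)"
  shows "k_smooth_on n S (\<lambda>x. \<Sum>i\<in>A. f i x)"
  using assms(2)
  by (induction A rule: infinite_finite_induct) (auto intro: k_smooth_on_add[OF assms(1)])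

lemma (in bounded_bilinear) k_smooth_on:
  assumes "open S" "k_smooth_on n S f" "k_smooth_on n S g"
  shows "k_smooth_on n S (\<lambda>x. prod (f x) (g x))"
  using assms(2,3)
proof (induction n arbitrary: f g)
  case 0
  then show ?case by (auto intro: continuous_on)
next
  case (Suc n)
  show ?case
  proof (rule k_smooth_on_SucI[OF assms(1)])
    fix x assume "x \<in> S"
    then show "((\<lambda>x. prod (f x) (g x)) has_derivative
      (\<lambda>v. prod (f x) (frechet_derivative g (at x) v) + prod (frechet_derivative f (at x) v) (g x))) (at x)"
      by (intro FDERIV k_smooth_on_has_derivative[OF Suc.prems(1)] k_smooth_on_has_derivative[OF Suc.prems(2)])
  next
    show "k_smooth_on n S (\<lambda>x. prod (f x) (frechet_derivative g (at x) v) + prod (frechet_derivative f (at x) v) (g x))" for v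
      using Suc.prems k_smooth_on_SucD[of n S f] k_smooth_on_SucD[of n S g]
      by (intro k_smooth_on_add assms(1) Suc.IH) simp_all
  qed
qed

lemma (in bounded_linear) k_smooth_on_comp:
  assumes "open S" "k_smooth_on n S g"
  shows "k_smooth_on n S (\<lambda>x. f (g x))"
  using assms(2)
proof (induction n arbitrary: g)
  case 0
  then show ?case by (auto intro: continuous_on)
next
  case (Suc n)
  show ?case
    by (rule k_smooth_on_SucI[OF assms(1), where f' = "\<lambda>x v. f (frechet_derivative g (at x) v)"])
      (use Suc in \<open>auto intro!: has_derivative simp: frechet_derivative_works[symmetric]\<close>)
qed

lemma k_smooth_on_id: "open S \<Longrightarrow> k_smooth_on n S (\<lambda>x. x)"
proof (cases n)
  case (Suc m)
  assume "open S"
  then show ?thesis unfolding Suc by (rule k_smooth_on_SucI[where f' = "\<lambda>x v. v"]) auto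
qed auto

lemma k_smooth_on_Pair:
  assumes "open S" "k_smooth_on n S f" "k_smooth_on n S g"
  shows "k_smooth_on n S (\<lambda>x. (f x, g x))"
proof -
  \<comment> \<open>The pair is the sum of its two linear embeddings (f, 0) and (0, g).\<close>
  have "bounded_linear (\<lambda>x. (x, 0))" "bounded_linear (\<lambda>x. (0, x))"
    by (intro bounded_linear_Pair bounded_linear_ident bounded_linear_zero)+
  from k_smooth_on_add[OF assms(1) bounded_linear.k_smooth_on_comp[OF this(1) assms(1,2)]
      bounded_linear.k_smooth_on_comp[OF this(2) assms(1,3)]]
  show ?thesis by simp
qed

text \<open>The chain rule yields g'(f x) applied to a direction that varies with x, whereas the
  recursion only controls fixed directions. Expanding f' x v in the basis gives a finite sum of
  scalars times g'(f x) b with b fixed, to which the induction hypothesis applies. This is where the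
  middle space has to be Euclidean.\<close>

lemma k_smooth_on_compose:
  fixes f :: "'a::real_normed_vector \<Rightarrow> 'b::euclidean_space"
  assumes "open S" "k_smooth_on n S f" "k_smooth_on n T g" "f ` S \<subseteq> T"
  shows "k_smooth_on n S (\<lambda>x. g (f x))"
  using assms(2,3)
proof (induction n arbitrary: g)
  case 0
  then show ?case using assms(4) by (auto intro: continuous_on_compose2)
next
  case (Suc n)
  let ?f' = "\<lambda>x. frechet_derivative f (at x)" and ?g' = "\<lambda>x. frechet_derivative g (at x)"
  have f: "k_smooth_on n S f" using Suc.prems(1) by (rule k_smooth_on_SucD)
  show ?case
  proof (rule k_smooth_on_SucI[OF assms(1)])
    fix x assume x: "x \<in> S"
    have g': "(g has_derivative ?g' (f x)) (at (f x))"
      using k_smooth_on_has_derivative[OF Suc.prems(2)] x assms(4) by blast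
    have "?g' (f x) (?f' x v) = (\<Sum>b\<in>Basis. (?f' x v \<bullet> b) *\<^sub>R ?g' (f x) b)" for v
    proof -
      interpret bounded_linear "?g' (f x)" using g' by (rule has_derivative_bounded_linear)
      show ?thesis by (subst (1) euclidean_representation[of "?f' x v", symmetric]) (simp add: sum scaleR)
    qed
    then show "((\<lambda>x. g (f x)) has_derivative (\<lambda>v. \<Sum>b\<in>Basis. (?f' x v \<bullet> b) *\<^sub>R ?g' (f x) b)) (at x)"
      using has_derivative_compose[OF k_smooth_on_has_derivative[OF Suc.prems(1) x] g'] by simp
  next
    show "k_smooth_on n S (\<lambda>x. \<Sum>b\<in>Basis. (?f' x v \<bullet> b) *\<^sub>R ?g' (f x) b)" for v
      using Suc.prems f
      by (intro k_smooth_on_sum assms(1) bounded_bilinear.k_smooth_on[OF bounded_bilinear_scaleR]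
          bounded_linear.k_smooth_on_comp[OF bounded_linear_inner_left] Suc.IH) auto
  qed
qed

lemma smooth_on_subset: "smooth_on S f \<Longrightarrow> T \<subseteq> S \<Longrightarrow> smooth_on T f"
  unfolding smooth_on_def by (auto intro: k_smooth_on_subset)

lemma smooth_on_cong:
  "open S \<Longrightarrow> (\<And>x. x \<in> S \<Longrightarrow> f x = g x) \<Longrightarrow> smooth_on S f \<Longrightarrow> smooth_on S g"
  unfolding smooth_on_def by (auto intro: k_smooth_on_cong)

lemma smooth_on_local:
  assumes "\<And>x. x \<in> S \<Longrightarrow> \<exists>U. open U \<and> x \<in> U \<and> smooth_on U f"
  shows "smooth_on S f"
  unfolding smooth_on_def
  by (metis assms k_smooth_on_local smooth_on_def)

lemma smooth_on_compose:
  fixes f :: "'a::real_normed_vector \<Rightarrow> 'b::euclidean_space"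
  shows "open S \<Longrightarrow> smooth_on S f \<Longrightarrow> smooth_on T g \<Longrightarrow> f ` S \<subseteq> T \<Longrightarrow> smooth_on S (\<lambda>x. g (f x))"
  unfolding smooth_on_def by (auto intro: k_smooth_on_compose)

lemma smooth_on_Pair:
  "open S \<Longrightarrow> smooth_on S f \<Longrightarrow> smooth_on S g \<Longrightarrow> smooth_on S (\<lambda>x. (f x, g x))"
  unfolding smooth_on_def by (auto intro: k_smooth_on_Pair)

lemma smooth_on_const [simp]: "smooth_on S (\<lambda>x. c)"
  by (simp add: smooth_on_def)

lemma smooth_on_id: "open S \<Longrightarrow> smooth_on S (\<lambda>x. x)"
  by (simp add: smooth_on_def k_smooth_on_id)

lemma smooth_on_has_derivative:
  "smooth_on S f \<Longrightarrow> x \<in> S \<Longrightarrow> (f has_derivative frechet_derivative f (at x)) (at x)"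
  unfolding smooth_on_def by (metis k_smooth_on_has_derivative)

lemma smooth_on_continuous: "smooth_on S f \<Longrightarrow> continuous_on S f"
  unfolding smooth_on_def by (metis k_smooth_on.simps(1))

lemma smooth_on_directional:
  "smooth_on S f \<Longrightarrow> smooth_on S (\<lambda>x. frechet_derivative f (at x) v)"
  unfolding smooth_on_def by (metis k_smooth_on.simps(2))

lemma smooth_on_affine_curve: "smooth_on S (\<lambda>\<epsilon>::real. a + \<epsilon> *\<^sub>R c)"
proof (rule smooth_on_subset)
  show "smooth_on UNIV (\<lambda>\<epsilon>::real. a + \<epsilon> *\<^sub>R c)"
    unfolding smooth_on_def
    by (auto intro!: k_smooth_on_add k_smooth_on_id
        bounded_linear.k_smooth_on_comp[OF bounded_linear_scaleR_left])
qed simp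


section \<open>Ordinary differential equations\<close>

text \<open>Each partial derivative is bounded on the compact ball; the sum of these bounds
  dominates the operator norm because every coordinate of v is at most the norm of v. Convexity of
  the ball then gives the Lipschitz estimate.\<close>

lemma k_smooth_on_imp_lipschitz:
  fixes F :: "'e::euclidean_space \<Rightarrow> 'b::real_normed_vector"
  assumes "k_smooth_on (Suc 0) S F" "cball x0 r \<subseteq> S"
  obtains C where "C-lipschitz_on (cball x0 r) F"
proof -
  let ?F' = "\<lambda>x. frechet_derivative F (at x)"
  have "\<exists>B. \<forall>x\<in>cball x0 r. norm (?F' x b) \<le> B" for b
  proof -
    have "compact ((\<lambda>x. ?F' x b) ` cball x0 r)"
      using assms by (intro compact_continuous_image) (auto intro: continuous_on_subset)
    from compact_imp_bounded[OF this] show ?thesis by (auto simp: bounded_iff)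
  qed
  then obtain B where B: "norm (?F' x b) \<le> B b" if "x \<in> cball x0 r" for x b by metis
  have "(\<Sum>b\<in>Basis. \<bar>B b\<bar>)-lipschitz_on (cball x0 r) F"
  proof (rule bounded_derivative_imp_lipschitz)
    fix x assume x: "x \<in> cball x0 r"
    have d: "(F has_derivative ?F' x) (at x)"
      using k_smooth_on_has_derivative[OF assms(1)] x assms(2) by blast
    then show "(F has_derivative ?F' x) (at x within cball x0 r)"
      by (rule has_derivative_at_withinI)
    interpret bounded_linear "?F' x" using d by (rule has_derivative_bounded_linear)
    show "onorm (?F' x) \<le> (\<Sum>b\<in>Basis. \<bar>B b\<bar>)"
    proof (rule onorm_le)
      fix v
      have "norm (?F' x v) = norm (\<Sum>b\<in>Basis. (v \<bullet> b) *\<^sub>R ?F' x b)"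
        by (subst (1) euclidean_representation[of v, symmetric]) (simp add: sum scaleR)
      also have "\<dots> \<le> (\<Sum>b\<in>Basis. \<bar>v \<bullet> b\<bar> * norm (?F' x b))"
        by (rule order_trans[OF norm_sum]) simp
      also have "\<dots> \<le> (\<Sum>b\<in>Basis. norm v * \<bar>B b\<bar>)"
      proof (rule sum_mono)
        fix b :: 'e assume "b \<in> Basis"
        then show "\<bar>v \<bullet> b\<bar> * norm (?F' x b) \<le> norm v * \<bar>B b\<bar>"
          using B[OF x, of b] by (intro mult_mono Basis_le_norm) auto
      qed
      finally show "norm (?F' x v) \<le> (\<Sum>b\<in>Basis. \<bar>B b\<bar>) * norm v"
        by (simp add: sum_distrib_left mult.commute)
    qed
  qed (auto simp: sum_nonneg)
  then show ?thesis by (rule that)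
qed

text \<open>The right-hand side is first extended to the whole space by projecting to the ball, and the
  time is clamped to a compact interval, so that the Picard operator acts on all bounded continuous
  functions.\<close>

lemma ode_local_solution:
  fixes F :: "'e::euclidean_space \<Rightarrow> 'e"
  assumes "C-lipschitz_on (cball x0 r) F" "r > 0"
  obtains T x where "T > 0" "x 0 = x0"
    "\<And>t. \<bar>t\<bar> < T \<Longrightarrow> x t \<in> cball x0 r \<and> (x has_vector_derivative F (x t)) (at t)"
proof -
  define P where "P = closest_point (cball x0 r)"
  define G where "G = F \<circ> P"
  have C: "C \<ge> 0" using assms(1) by (simp add: lipschitz_on_def)
  have P_in: "P x \<in> cball x0 r" for x
    unfolding P_def using assms(2) by (intro closest_point_in_set) auto
  \<comment> \<open>Projection to a closed convex set does not increase distances, so the extension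
    keeps the constant C.\<close>
  have G_lip: "dist (G x) (G y) \<le> C * dist x y" for x y
  proof -
    have "dist (G x) (G y) \<le> C * dist (P x) (P y)"
      unfolding G_def o_def using assms(1) P_in P_in by (rule lipschitz_onD)
    also have "dist (P x) (P y) \<le> dist x y"
      unfolding P_def using assms(2) by (intro closest_point_lipschitz) auto
    finally show ?thesis using C by (simp add: mult_left_mono)
  qed
  have G_cont: "continuous_on S (\<lambda>s. G (u s))" if "continuous_on S u" for S and u :: "real \<Rightarrow> 'e"
  proof -
    have "C-lipschitz_on UNIV G" using G_lip C by (simp add: lipschitz_on_def)
    from lipschitz_on_continuous_on[OF this] show ?thesis
      using continuous_on_compose2[OF _ that, of UNIV G] by simp
  qed
  obtain M where M: "norm (G x) \<le> M" for x
  proof -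
    have "bounded (F ` cball x0 r)"
      by (intro compact_imp_bounded compact_continuous_image lipschitz_on_continuous_on[OF assms(1)]) simp
    then obtain M where "\<forall>y\<in>F ` cball x0 r. norm y \<le> M" by (auto simp: bounded_iff)
    then show ?thesis using P_in that[of M] by (simp add: G_def)
  qed
  then have M0: "M \<ge> 0" using order_trans[OF norm_ge_zero] by blast
  \<comment> \<open>The first bound makes the Picard operator a contraction with factor 4TC \<le>
    1/2, the second keeps its values within 4TM \<le> r of \<open>x0\<close>. Adding 1 avoids
    division by zero.\<close>
  define T where "T = min (1 / (8 * (C + 1))) (r / (4 * (M + 1)))"
  have T: "T > 0" unfolding T_def using C M0 assms(2) by simp
  have "T * (8 * (C + 1)) \<le> 1" "T * (4 * (M + 1)) \<le> r"
    unfolding T_def using C M0 by (auto simp: pos_le_divide_eq[symmetric])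
  then have TC: "4 * T * C \<le> 1 / 2" and TM: "4 * T * M \<le> r"
    using T C M0 by (auto simp: algebra_simps)
  define p where "p t = max (- T) (min T t)" for t :: real
  have p: "p t \<in> {-T..T}" and p_id: "\<bar>t\<bar> \<le> T \<Longrightarrow> p t = t" for t
    using T by (auto simp: p_def)
  \<comment> \<open>The integral starts at -T because an integral over {0..t} would vanish for
    negative t. Subtracting \<open>J u 0\<close> in \<open>Q\<close> restores the integral from 0
    for both signs, at the price of doubling the estimates.\<close>
  define J where "J u t = integral {-T..t} (\<lambda>s. G (u s))" for u :: "real \<Rightarrow> 'e" and t
  have int: "(\<lambda>s. G (u s)) integrable_on {-T..t}" if "continuous_on UNIV u" for u t
    using G_cont[OF continuous_on_subset[OF that subset_UNIV]] by (intro integrable_continuous_real)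
  have J_bound: "norm (J u t) \<le> 2 * T * M" if "continuous_on UNIV u" "t \<in> {-T..T}" for u t
  proof -
    have "norm (J u t) \<le> M * (t - - T)"
      unfolding J_def using that M
      by (intro integral_bound G_cont continuous_on_subset[OF that(1) subset_UNIV]) auto
    also have "\<dots> \<le> M * (2 * T)" using that M0 by (intro mult_left_mono) auto
    finally show ?thesis by (simp add: mult_ac)
  qed
  have J_dist: "norm (J u t - J v t) \<le> 2 * T * (C * dist u v)" if "t \<in> {-T..T}" for u v :: "real \<Rightarrow>\<^sub>C 'e" and t
  proof -
    have "J u t - J v t = integral {-T..t} (\<lambda>s. G (u s) - G (v s))"
      unfolding J_def by (intro integral_diff[symmetric] int) auto
    also have "norm \<dots> \<le> (C * dist u v) * (t - - T)"
    proof (intro integral_bound)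
      show "norm (G (u s) - G (v s)) \<le> C * dist u v" for s
        using order_trans[OF G_lip mult_left_mono[OF dist_bounded[of u s v] C]] by (simp add: dist_norm)
      show "- T \<le> t" using that by simp
    qed (auto intro!: continuous_intros G_cont)
    also have "\<dots> \<le> (C * dist u v) * (2 * T)" using that C by (intro mult_left_mono) auto
    finally show ?thesis by (simp add: mult_ac)
  qed
  define Q where "Q u t = x0 + (J u (p t) - J u 0)" for u :: "real \<Rightarrow> 'e" and t
  have Q_bound: "norm (Q u t - x0) \<le> 4 * T * M" if "continuous_on UNIV u" for u t
    using J_bound[OF that p, of t] J_bound[OF that, of 0] T
      norm_triangle_ineq4[of "J u (p t)" "J u 0"] by (simp add: Q_def)
  have Q_bcont: "Q u \<in> bcontfun" for u :: "real \<Rightarrow>\<^sub>C 'e"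
  proof -
    have "continuous_on {-T..T} (J u)"
      unfolding J_def by (intro indefinite_integral_continuous_1 int) simp
    then have "continuous_on UNIV (\<lambda>t. J u (p t))"
      by (rule continuous_on_compose2) (use p in \<open>auto simp: p_def intro!: continuous_intros\<close>)
    then have "continuous_on UNIV (Q u)"
      unfolding Q_def by (auto intro!: continuous_intros)
    moreover have "bounded (range (Q u))"
      unfolding bounded_def using Q_bound[of u] 
      by (intro exI[of _ x0] exI[of _ "4 * T * M"]) (auto simp: dist_norm norm_minus_commute)
    ultimately show ?thesis by (simp add: bcontfun_def)
  qed
  \<comment> \<open>Contraction principle in the complete space of bounded continuous
    functions.\<close>
  have "\<exists>!u. Bcontfun (Q (apply_bcontfun u)) = u"
  proof (rule banach_fix_type[of "1/2"], simp, simp, intro allI)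
    fix u v :: "real \<Rightarrow>\<^sub>C 'e"
    have "dist (Bcontfun (Q u)) (Bcontfun (Q v)) \<le> 4 * T * C * dist u v"
    proof (rule dist_bound)
      fix t
      have "dist (Q u t) (Q v t) = norm ((J u (p t) - J v (p t)) - (J u 0 - J v 0))"
        by (simp add: Q_def dist_norm algebra_simps)
      also have "\<dots> \<le> 2 * T * (C * dist u v) + 2 * T * (C * dist u v)"
        by (rule order_trans[OF norm_triangle_ineq4 add_mono]) (use J_dist p T in auto)
      finally show "dist (Bcontfun (Q u) t) (Bcontfun (Q v) t) \<le> 4 * T * C * dist u v"
        by (simp add: Bcontfun_inverse[OF Q_bcont] mult_ac)
    qed
    also have "\<dots> \<le> 1 / 2 * dist u v" using TC by (intro mult_right_mono) auto
    finally show "dist (Bcontfun (Q u)) (Bcontfun (Q v)) \<le> 1 / 2 * dist u v" .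
  qed
  then obtain u where "Bcontfun (Q (apply_bcontfun u)) = u" by blast
  then have u: "u t = Q u t" for t using Bcontfun_inverse[OF Q_bcont, of u] by metis
  have u_in: "u t \<in> cball x0 r" for t
    using Q_bound[of u t] TM u[of t] by (simp add: dist_norm norm_minus_commute)
  show ?thesis
  proof (rule that[OF T])
    show "u 0 = x0" using u[of 0] p_id[of 0] T by (simp add: Q_def)
    fix t :: real assume t: "\<bar>t\<bar> < T"
    \<comment> \<open>The fixed point never leaves the ball, so the projection acts as the identity
      along it and the original equation is recovered.\<close>
    have GF: "G (u s) = F (u s)" for s
      using u_in by (simp add: G_def P_def closest_point_self)
    have "(J u has_vector_derivative G (u t)) (at t within {-T..T})"
      unfolding J_def using t by (intro integral_has_vector_derivative G_cont) auto
    moreover have "at t within {-T..T} = at t" using t by (intro at_within_interior) auto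
    ultimately have "(J u has_vector_derivative F (u t)) (at t)" by (simp add: GF)
    then have "((\<lambda>t. x0 + (J u t - J u 0)) has_vector_derivative F (u t)) (at t)"
      by (auto intro!: derivative_eq_intros)
    moreover have "u s = x0 + (J u s - J u 0)" if "s \<in> {-T<..<T}" for s
      using that u[of s] p_id[of s] by (simp add: Q_def abs_le_iff)
    ultimately have "(u has_vector_derivative F (u t)) (at t)"
      using t by (intro has_vector_derivative_transform_within_open[of _ _ _ "{-T<..<T}" u]) auto
    then show "u t \<in> cball x0 r \<and> (u has_vector_derivative F (u t)) (at t)"
      using u_in by simp
  qed
qed

text \<open>The function \<open>|x - y|\<^sup>2 exp (- 2 C t)\<close> decreases.\<close>

lemma ode_unique_nonneg:
  fixes x y :: "real \<Rightarrow> 'e::euclidean_space"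
  assumes "C-lipschitz_on K F" "x 0 = y 0" "0 \<le> t" "t < T"
    and x: "\<And>t. \<bar>t\<bar> < T \<Longrightarrow> x t \<in> K \<and> (x has_vector_derivative F (x t)) (at t)"
    and y: "\<And>t. \<bar>t\<bar> < T \<Longrightarrow> y t \<in> K \<and> (y has_vector_derivative F (y t)) (at t)"
  shows "x t = y t"
proof -
  define w where "w s = ((x s - y s) \<bullet> (x s - y s)) * exp (- 2 * C * s)" for s
  have "w t \<le> w 0"
  proof (rule DERIV_nonpos_imp_nonincreasing[OF \<open>0 \<le> t\<close>])
    fix s assume s: "0 \<le> s" "s \<le> t"
    then have "\<bar>s\<bar> < T" using assms(4) by simp
    note xy = x[OF this] y[OF this]
    let ?d = "x s - y s" and ?D = "F (x s) - F (y s)"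
    have "((\<lambda>s. x s - y s) has_vector_derivative ?D) (at s)"
      using xy by (auto intro: has_vector_derivative_diff)
    then have d: "((\<lambda>s. x s - y s) has_derivative (\<lambda>u. u *\<^sub>R ?D)) (at s)"
      by (simp add: has_vector_derivative_def)
    have "((\<lambda>s. (x s - y s) \<bullet> (x s - y s)) has_real_derivative 2 * (?D \<bullet> ?d)) (at s)"
      unfolding has_field_derivative_def
      by (rule has_derivative_eq_rhs[OF has_derivative_inner[OF d d]])
        (simp add: fun_eq_iff inner_commute[of ?d])
    then have "(w has_real_derivative (2 * (?D \<bullet> ?d) - 2 * C * (?d \<bullet> ?d)) * exp (- 2 * C * s)) (at s)"
      unfolding w_def
      by (rule DERIV_cong[OF DERIV_mult[OF _ DERIV_fun_exp[OF DERIV_cmult[OF DERIV_ident]]]])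
        (simp_all add: algebra_simps)
    moreover have "?D \<bullet> ?d \<le> C * (?d \<bullet> ?d)"
    proof -
      have "?D \<bullet> ?d \<le> norm ?D * norm ?d" by (rule norm_cauchy_schwarz)
      also have "norm ?D \<le> C * norm ?d"
        using lipschitz_onD[OF assms(1)] xy by (simp add: dist_norm)
      finally show ?thesis by (simp add: dot_square_norm power2_eq_square mult_right_mono mult.assoc)
    qed
    ultimately show "\<exists>w'. (w has_real_derivative w') (at s) \<and> w' \<le> 0"
      by (intro exI[of _ "(2 * (?D \<bullet> ?d) - 2 * C * (?d \<bullet> ?d)) * exp (- 2 * C * s)"])
        (simp add: mult_nonpos_nonneg)
  qed
  then have "(x t - y t) \<bullet> (x t - y t) \<le> 0"
    using assms(2) by (simp add: w_def mult_le_0_iff)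
  then show ?thesis by (metis inner_gt_zero_iff less_le_not_le right_minus_eq)
qed

text \<open>Negative times reduce to nonnegative ones: t \<mapsto> x(-t) solves the equation for -F,
  which has the same Lipschitz constant.\<close>

lemma ode_unique:
  fixes x y :: "real \<Rightarrow> 'e::euclidean_space"
  assumes "C-lipschitz_on K F" "x 0 = y 0" "\<bar>t\<bar> < T"
    and x: "\<And>t. \<bar>t\<bar> < T \<Longrightarrow> x t \<in> K \<and> (x has_vector_derivative F (x t)) (at t)"
    and y: "\<And>t. \<bar>t\<bar> < T \<Longrightarrow> y t \<in> K \<and> (y has_vector_derivative F (y t)) (at t)"
  shows "x t = y t"
proof (cases "t \<ge> 0")
  case True
  then show ?thesis using ode_unique_nonneg[OF assms(1,2) _ _ x y] assms(3) by auto
next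
  case False
  have rev: "((\<lambda>t. z (- t)) has_vector_derivative - F (z (- t))) (at t)"
    if "(z has_vector_derivative F (z (- t))) (at (- t))" for z t
  proof -
    have "((\<lambda>t::real. - t) has_vector_derivative - 1) (at t)"
      by (auto intro!: derivative_eq_intros)
    from vector_diff_chain_at[OF this that] show ?thesis by (simp add: o_def)
  qed
  have "C-lipschitz_on K (\<lambda>z. - F z)" using assms(1) by (simp add: lipschitz_on_def dist_minus)
  then have "x (- (- t)) = y (- (- t))"
    by (rule ode_unique_nonneg[where T = T]) (use False assms(2,3) x y rev in auto)
  then show ?thesis by simp
qed


section \<open>Smooth maps between manifolds\<close>

text \<open>The topological part of an atlas suffices to compose smooth maps. Analyticity of the
  transition maps, which is laborious for vector spaces and products, is not carried along.\<close>

definition cont_atlas :: "('g::topological_space, 'e::topological_space) chart set \<Rightarrow> bool" where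
  "cont_atlas A \<longleftrightarrow>
     (\<Union>(U, \<phi>)\<in>A. U) = UNIV \<and>
     (\<forall>(U, \<phi>)\<in>A. open U \<and> open (\<phi> ` U) \<and> homeomorphism U (\<phi> ` U) \<phi> (inv_into U \<phi>))"

lemma analytic_imp_cont_atlas: "analytic_atlas A \<Longrightarrow> cont_atlas A"
  unfolding analytic_atlas_def cont_atlas_def by blast

lemma cont_atlas_vector: "cont_atlas vector_atlas"
  by (auto simp: cont_atlas_def vector_atlas_def homeomorphism_def)

lemma cont_atlasD:
  assumes "cont_atlas A" "(U, \<phi>) \<in> A"
  shows "open U" "open (\<phi> ` U)" "inj_on \<phi> U" "continuous_on U \<phi>" "continuous_on (\<phi> ` U) (inv_into U \<phi>)"
    "W \<subseteq> U \<Longrightarrow> open W \<Longrightarrow> open (\<phi> ` W)"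
proof -
  have h: "open U" "open (\<phi> ` U)" "homeomorphism U (\<phi> ` U) \<phi> (inv_into U \<phi>)"
    using assms unfolding cont_atlas_def by auto
  then show "open U" "open (\<phi> ` U)" "inj_on \<phi> U" "continuous_on U \<phi>" "continuous_on (\<phi> ` U) (inv_into U \<phi>)"
    by (auto simp: homeomorphism_def intro: inj_on_inverseI)
  assume "W \<subseteq> U" "open W"
  then have "openin (top_of_set (\<phi> ` U)) (\<phi> ` W)"
    using homeomorphism_imp_open_map[OF h(3)] by (meson h(1) open_subset openin_open_eq)
  then show "open (\<phi> ` W)" using h(2) by (simp add: openin_open_eq)
qed

lemma cont_atlas_chart_at:
  assumes "cont_atlas A" obtains U \<phi> where "(U, \<phi>) \<in> A" "x \<in> U"
  using assms unfolding cont_atlas_def by fastforce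

lemma inv_into_map_prod:
  assumes "inj_on \<phi> U" "inj_on \<psi> W" "x \<in> \<phi> ` U" "y \<in> \<psi> ` W"
  shows "inv_into (U \<times> W) (map_prod \<phi> \<psi>) (x, y) = (inv_into U \<phi> x, inv_into W \<psi> y)"
proof (rule inv_into_f_eq)
  show "inj_on (map_prod \<phi> \<psi>) (U \<times> W)" using assms(1,2) by (rule map_prod_inj_on)
qed (use assms in \<open>auto simp: inv_into_into f_inv_into_f\<close>)

lemma cont_atlas_prod:
  assumes "cont_atlas A" "cont_atlas B"
  shows "cont_atlas (prod_atlas A B)"
  unfolding cont_atlas_def
proof
  have "p \<in> (\<Union>(U, \<phi>)\<in>prod_atlas A B. U)" for p
  proof -
    obtain U \<phi> where U: "(U, \<phi>) \<in> A" "fst p \<in> U" using assms(1) by (rule cont_atlas_chart_at)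
    obtain W \<psi> where W: "(W, \<psi>) \<in> B" "snd p \<in> W" using assms(2) by (rule cont_atlas_chart_at)
    have "(U \<times> W, map_prod \<phi> \<psi>) \<in> prod_atlas A B" using U W by (auto simp: prod_atlas_def)
    moreover have "p \<in> U \<times> W" using U W by (cases p) auto
    ultimately show ?thesis by blast
  qed
  then show "(\<Union>(U, \<phi>)\<in>prod_atlas A B. U) = UNIV" by blast
  have "open (U \<times> W) \<and> open (map_prod \<phi> \<psi> ` (U \<times> W)) \<and>
      homeomorphism (U \<times> W) (map_prod \<phi> \<psi> ` (U \<times> W)) (map_prod \<phi> \<psi>) (inv_into (U \<times> W) (map_prod \<phi> \<psi>))"
    if "(U, \<phi>) \<in> A" "(W, \<psi>) \<in> B" for U \<phi> W \<psi>
  proof (intro conjI)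
    note a = cont_atlasD[OF assms(1) that(1)] and b = cont_atlasD[OF assms(2) that(2)]
    have img: "map_prod \<phi> \<psi> ` (U \<times> W) = \<phi> ` U \<times> \<psi> ` W" by (rule map_prod_surj_on) auto
    show "open (U \<times> W)" using a b by (simp add: open_Times)
    show "open (map_prod \<phi> \<psi> ` (U \<times> W))" using a b by (simp add: img open_Times)
    have inj: "inj_on (map_prod \<phi> \<psi>) (U \<times> W)" using a(3) b(3) by (rule map_prod_inj_on)
    show "homeomorphism (U \<times> W) (map_prod \<phi> \<psi> ` (U \<times> W)) (map_prod \<phi> \<psi>) (inv_into (U \<times> W) (map_prod \<phi> \<psi>))"
      unfolding homeomorphism_def
    proof (intro conjI)
      show "continuous_on (U \<times> W) (map_prod \<phi> \<psi>)"
        unfolding map_prod_def case_prod_beta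
        by (intro continuous_on_Pair continuous_on_compose2[OF a(4)] continuous_on_compose2[OF b(4)]
            continuous_on_fst continuous_on_snd continuous_on_id) auto
      have "continuous_on (\<phi> ` U \<times> \<psi> ` W) (\<lambda>p. (inv_into U \<phi> (fst p), inv_into W \<psi> (snd p)))"
        by (intro continuous_on_Pair continuous_on_compose2[OF a(5)] continuous_on_compose2[OF b(5)]
            continuous_on_fst continuous_on_snd continuous_on_id) auto
      then show "continuous_on (map_prod \<phi> \<psi> ` (U \<times> W)) (inv_into (U \<times> W) (map_prod \<phi> \<psi>))"
        unfolding img by (rule continuous_on_eq) (auto simp: inv_into_map_prod a(3) b(3))
      show "inv_into (U \<times> W) (map_prod \<phi> \<psi>) ` map_prod \<phi> \<psi> ` (U \<times> W) = U \<times> W"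
        using inj by (rule inv_into_image_cancel) simp
    qed (use inj in \<open>auto simp del: map_prod_simp intro: f_inv_into_f\<close>)
  qed
  then show "\<forall>(U, \<phi>)\<in>prod_atlas A B. open U \<and> open (\<phi> ` U) \<and> homeomorphism U (\<phi> ` U) \<phi> (inv_into U \<phi>)"
    by (auto simp: prod_atlas_def)
qed

lemma smooth_map_onD:
  assumes "smooth_map_on X A B f"
  shows "open X" "continuous_on X f"
    "(U, \<phi>) \<in> A \<Longrightarrow> (W, \<psi>) \<in> B \<Longrightarrow> smooth_on (\<phi> ` (U \<inter> X \<inter> f -` W)) (\<lambda>x. \<psi> (f (inv_into U \<phi> x)))"
  using assms by (auto simp: regular_map_on_def o_def)

lemma smooth_map_onI:
  assumes "open X" "continuous_on X f"
    "\<And>U \<phi> W \<psi>. (U, \<phi>) \<in> A \<Longrightarrow> (W, \<psi>) \<in> B \<Longrightarrow>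
      smooth_on (\<phi> ` (U \<inter> X \<inter> f -` W)) (\<lambda>x. \<psi> (f (inv_into U \<phi> x)))"
  shows "smooth_map_on X A B f"
  using assms by (auto simp: regular_map_on_def o_def)

lemma analytic_imp_smooth_map: "analytic_map_on X A B f \<Longrightarrow> smooth_map_on X A B f"
  unfolding regular_map_on_def real_analytic_on_def by fast

lemma smooth_map_on_open_vimage:
  "smooth_map_on X A B f \<Longrightarrow> open V \<Longrightarrow> open (X \<inter> f -` V)"
  using continuous_open_preimage[OF smooth_map_onD(2) smooth_map_onD(1)] by blast

lemma smooth_map_on_subset:
  "smooth_map_on X A B f \<Longrightarrow> open Y \<Longrightarrow> Y \<subseteq> X \<Longrightarrow> smooth_map_on Y A B f"
  by (rule smooth_map_onI)
    (auto intro: continuous_on_subset smooth_on_subset dest: smooth_map_onD)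

text \<open>Charts map small open neighbourhoods to open sets, so local smoothness can be checked
  there. It will glue the translates of a local one-parameter group along the real line.\<close>

lemma smooth_map_on_local:
  assumes A: "cont_atlas A" and loc: "\<And>x. x \<in> X \<Longrightarrow> \<exists>Y. x \<in> Y \<and> smooth_map_on Y A B f" and X: "open X"
    and B: "cont_atlas B"
  shows "smooth_map_on X A B f"
proof (rule smooth_map_onI[OF X])
  show "continuous_on X f"
  proof (rule continuous_on_subset)
    show "continuous_on (\<Union>{Y. smooth_map_on Y A B f}) f"
      by (rule continuous_on_open_Union) (auto dest: smooth_map_onD)
  qed (use loc in blast)
  fix U \<phi> W \<psi> assume ch: "(U, \<phi>) \<in> A" "(W, \<psi>) \<in> B"
  show "smooth_on (\<phi> ` (U \<inter> X \<inter> f -` W)) (\<lambda>x. \<psi> (f (inv_into U \<phi> x)))"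
  proof (rule smooth_on_local)
    fix x assume "x \<in> \<phi> ` (U \<inter> X \<inter> f -` W)"
    then obtain p where p: "x = \<phi> p" "p \<in> U" "p \<in> X" "f p \<in> W" by blast
    then obtain Y where Y: "p \<in> Y" "smooth_map_on Y A B f" using loc by blast
    have "open (U \<inter> (Y \<inter> f -` W))"
      using smooth_map_on_open_vimage[OF Y(2) cont_atlasD(1)[OF B ch(2)]] cont_atlasD(1)[OF A ch(1)] by blast
    then have "open (\<phi> ` (U \<inter> Y \<inter> f -` W))"
      by (intro cont_atlasD(6)[OF A ch(1)]) (auto simp: Int_assoc)
    then show "\<exists>V. open V \<and> x \<in> V \<and> smooth_on V (\<lambda>x. \<psi> (f (inv_into U \<phi> x)))"
      using smooth_map_onD(3)[OF Y(2) ch] p Y(1) by blast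
  qed
qed

text \<open>Around each point a chart \<psi> of the middle manifold is inserted, and the coordinate
  expression splits into those of f and g. Smoothness is given in all charts, so any chart around f
  p will do.\<close>

lemma smooth_map_on_compose:
  fixes B :: "('b::topological_space, 'd::euclidean_space) chart set"
    and A :: "('a::topological_space, 'c::real_normed_vector) chart set"
  assumes A: "cont_atlas A" and B: "cont_atlas B" and C: "cont_atlas C"
    and f: "smooth_map_on X A B f" and g: "smooth_map_on Y B C g"
  shows "smooth_map_on (X \<inter> f -` Y) A C (\<lambda>x. g (f x))"
proof (rule smooth_map_onI)
  have opn: "open (X \<inter> f -` Y)" using smooth_map_on_open_vimage[OF f smooth_map_onD(1)[OF g]] .
  then show "open (X \<inter> f -` Y)" .
  show cont: "continuous_on (X \<inter> f -` Y) (\<lambda>x. g (f x))"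
    by (rule continuous_on_compose2[OF smooth_map_onD(2)[OF g] continuous_on_subset[OF smooth_map_onD(2)[OF f]]]) auto
  fix U \<phi> Z \<theta> assume ch: "(U, \<phi>) \<in> A" "(Z, \<theta>) \<in> C"
  show "smooth_on (\<phi> ` (U \<inter> (X \<inter> f -` Y) \<inter> (\<lambda>x. g (f x)) -` Z)) (\<lambda>x. \<theta> (g (f (inv_into U \<phi> x))))"
  proof (rule smooth_on_local)
    fix x assume "x \<in> \<phi> ` (U \<inter> (X \<inter> f -` Y) \<inter> (\<lambda>x. g (f x)) -` Z)"
    then obtain p where p: "x = \<phi> p" "p \<in> U" "p \<in> X" "f p \<in> Y" "g (f p) \<in> Z" by blast
    obtain W \<psi> where W: "(W, \<psi>) \<in> B" "f p \<in> W" using B by (rule cont_atlas_chart_at)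
    \<comment> \<open>The neighbourhood is cut down until f takes values in the chart W and in the
      part of Y that g sends to Z.\<close>
    let ?V = "U \<inter> (X \<inter> f -` (W \<inter> (Y \<inter> g -` Z)))"
    note a = cont_atlasD[OF A ch(1)] and b = cont_atlasD[OF B W(1)]
    have "open (W \<inter> (Y \<inter> g -` Z))"
      using smooth_map_on_open_vimage[OF g cont_atlasD(1)[OF C ch(2)]] b(1) by blast
    then have "open ?V" using smooth_map_on_open_vimage[OF f] a(1) by blast
    then have oV: "open (\<phi> ` ?V)" by (intro a(6)) auto
    let ?f = "\<lambda>x. \<psi> (f (inv_into U \<phi> x))" and ?g = "\<lambda>y. \<theta> (g (inv_into W \<psi> y))"
    have inv: "inv_into U \<phi> (\<phi> q) = q" if "q \<in> U" for q using a(3) that by simp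
    have invW: "inv_into W \<psi> (\<psi> q) = q" if "q \<in> W" for q using b(3) that by simp
    have "smooth_on (\<phi> ` ?V) (\<lambda>x. ?g (?f x))"
    proof (rule smooth_on_compose[OF oV])
      show "smooth_on (\<phi> ` ?V) ?f"
        by (rule smooth_on_subset[OF smooth_map_onD(3)[OF f ch(1) W(1)]]) auto
      show "smooth_on (\<psi> ` (W \<inter> Y \<inter> g -` Z)) ?g"
        by (rule smooth_map_onD(3)[OF g W(1) ch(2)])
    qed (auto simp: inv)
    then have "smooth_on (\<phi> ` ?V) (\<lambda>x. \<theta> (g (f (inv_into U \<phi> x))))"
      by (rule smooth_on_cong[OF oV, rotated]) (auto simp: inv invW)
    moreover have "x \<in> \<phi> ` ?V" using p W(2) by auto
    ultimately show "\<exists>V. open V \<and> x \<in> V \<and> smooth_on V (\<lambda>x. \<theta> (g (f (inv_into U \<phi> x))))"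
      using oV by blast
  qed
qed

lemma smooth_map_on_const: "open X \<Longrightarrow> smooth_map_on X A B (\<lambda>x. c)"
  by (rule smooth_map_onI) auto

lemma smooth_map_on_Pair:
  assumes A: "cont_atlas A" and B: "cont_atlas B" and C: "cont_atlas C"
    and f: "smooth_map_on X A B f" and g: "smooth_map_on X A C g"
  shows "smooth_map_on X A (prod_atlas B C) (\<lambda>x. (f x, g x))"
proof (rule smooth_map_onI)
  show X: "open X" using smooth_map_onD(1)[OF f] .
  show "continuous_on X (\<lambda>x. (f x, g x))"
    using smooth_map_onD(2)[OF f] smooth_map_onD(2)[OF g] by (rule continuous_on_Pair)
  fix U \<phi> Z \<theta> assume ch: "(U, \<phi>) \<in> A" "(Z, \<theta>) \<in> prod_atlas B C"
  obtain W \<psi> W' \<psi>' where Z: "Z = W \<times> W'" "\<theta> = map_prod \<psi> \<psi>'" "(W, \<psi>) \<in> B" "(W', \<psi>') \<in> C"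
    using ch(2) by (auto simp: prod_atlas_def)
  have "open (U \<inter> ((X \<inter> f -` W) \<inter> (X \<inter> g -` W')))"
    by (intro open_Int[OF cont_atlasD(1)[OF A ch(1)] open_Int[OF smooth_map_on_open_vimage[OF f]
          smooth_map_on_open_vimage[OF g]]] cont_atlasD(1)[OF B Z(3)] cont_atlasD(1)[OF C Z(4)])
  then have "open (\<phi> ` (U \<inter> ((X \<inter> f -` W) \<inter> (X \<inter> g -` W'))))"
    by (intro cont_atlasD(6)[OF A ch(1)]) auto
  moreover have "U \<inter> ((X \<inter> f -` W) \<inter> (X \<inter> g -` W')) = U \<inter> X \<inter> (\<lambda>x. (f x, g x)) -` Z"
    by (auto simp: Z)
  ultimately have opn: "open (\<phi> ` (U \<inter> X \<inter> (\<lambda>x. (f x, g x)) -` Z))" by simp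
  show "smooth_on (\<phi> ` (U \<inter> X \<inter> (\<lambda>x. (f x, g x)) -` Z)) (\<lambda>x. \<theta> (f (inv_into U \<phi> x), g (inv_into U \<phi> x)))"
    unfolding Z(2) map_prod_simp
  proof (rule smooth_on_Pair[OF opn])
    show "smooth_on (\<phi> ` (U \<inter> X \<inter> (\<lambda>x. (f x, g x)) -` Z)) (\<lambda>x. \<psi> (f (inv_into U \<phi> x)))"
      by (rule smooth_on_subset[OF smooth_map_onD(3)[OF f ch(1) Z(3)]]) (auto simp: Z)
    show "smooth_on (\<phi> ` (U \<inter> X \<inter> (\<lambda>x. (f x, g x)) -` Z)) (\<lambda>x. \<psi>' (g (inv_into U \<phi> x)))"
      by (rule smooth_on_subset[OF smooth_map_onD(3)[OF g ch(1) Z(4)]]) (auto simp: Z)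
  qed
qed

lemma smooth_map_on_cong:
  assumes A: "cont_atlas A" and B: "cont_atlas B"
    and f: "smooth_map_on X A B f" and eq: "\<And>x. x \<in> X \<Longrightarrow> f x = g x"
  shows "smooth_map_on X A B g"
proof (rule smooth_map_onI)
  show X: "open X" using smooth_map_onD(1)[OF f] .
  show "continuous_on X g" using smooth_map_onD(2)[OF f] eq by (simp cong: continuous_on_cong_simp)
  fix U \<phi> W \<psi> assume ch: "(U, \<phi>) \<in> A" "(W, \<psi>) \<in> B"
  have V: "U \<inter> X \<inter> g -` W = U \<inter> X \<inter> f -` W" using eq by auto
  have "open (U \<inter> (X \<inter> f -` W))"
    by (intro open_Int[OF cont_atlasD(1)[OF A ch(1)] smooth_map_on_open_vimage[OF f]] cont_atlasD(1)[OF B ch(2)])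
  then have "open (\<phi> ` (U \<inter> X \<inter> f -` W))"
    by (intro cont_atlasD(6)[OF A ch(1)]) (auto simp: Int_assoc)
  then show "smooth_on (\<phi> ` (U \<inter> X \<inter> g -` W)) (\<lambda>x. \<psi> (g (inv_into U \<phi> x)))"
    unfolding V
    by (rule smooth_on_cong[OF _ _ smooth_map_onD(3)[OF f ch]])
      (use eq cont_atlasD(3)[OF A ch(1)] in auto)
qed

lemma inv_into_UNIV_id [simp]: "inv_into UNIV id = id" "inv_into UNIV (\<lambda>x. x) = (\<lambda>x. x)"
  by (simp_all add: fun_eq_iff inv_into_f_f[of id] inv_into_f_f[of "\<lambda>x. x"])

lemma smooth_map_on_vector_iff:
  "smooth_map_on X vector_atlas vector_atlas f \<longleftrightarrow> open X \<and> smooth_on X f"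
  by (auto simp: regular_map_on_def vector_atlas_def o_def dest: smooth_on_continuous)

text \<open>Since the vector space carries the single chart \<open>id\<close>, the coordinate
  expressions of \<phi> are transition maps of the atlas; the same holds for its inverse
  below.\<close>

lemma smooth_map_on_chart:
  assumes "analytic_atlas A" "(U, \<phi>) \<in> A"
  shows "smooth_map_on U A vector_atlas \<phi>"
proof (rule smooth_map_onI)
  note c = cont_atlasD[OF analytic_imp_cont_atlas[OF assms(1)] assms(2)]
  show "open U" "continuous_on U \<phi>" using c by auto
  fix V \<psi> and W :: "'b set" and \<theta> :: "'b \<Rightarrow> 'b" assume ch: "(V, \<psi>) \<in> A" "(W, \<theta>) \<in> vector_atlas"
  have "smooth_on (\<psi> ` (V \<inter> U)) (\<phi> \<circ> inv_into V \<psi>)"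
    using assms ch(1) unfolding analytic_atlas_def real_analytic_on_def by fast
  then show "smooth_on (\<psi> ` (V \<inter> U \<inter> \<phi> -` W)) (\<lambda>x. \<theta> (\<phi> (inv_into V \<psi> x)))"
    using ch(2) by (simp add: vector_atlas_def o_def)
qed

lemma smooth_map_on_inv_chart:
  assumes "analytic_atlas A" "(U, \<phi>) \<in> A"
  shows "smooth_map_on (\<phi> ` U) vector_atlas A (inv_into U \<phi>)"
proof (rule smooth_map_onI)
  note c = cont_atlasD[OF analytic_imp_cont_atlas[OF assms(1)] assms(2)]
  show "open (\<phi> ` U)" "continuous_on (\<phi> ` U) (inv_into U \<phi>)" using c by auto
  fix V \<psi> and W :: "'b set" and \<theta> :: "'b \<Rightarrow> 'b" assume ch: "(V, \<psi>) \<in> A" "(W, \<theta>) \<in> vector_atlas"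
  have "smooth_on (\<phi> ` (U \<inter> V)) (\<psi> \<circ> inv_into U \<phi>)"
    using assms ch(1) unfolding analytic_atlas_def real_analytic_on_def by fast
  moreover have "\<theta> ` (W \<inter> \<phi> ` U \<inter> inv_into U \<phi> -` V) = \<phi> ` (U \<inter> V)"
    using ch(2) c(3) by (auto simp: vector_atlas_def image_iff)
  ultimately show "smooth_on (\<theta> ` (W \<inter> \<phi> ` U \<inter> inv_into U \<phi> -` V)) (\<lambda>x. \<psi> (inv_into U \<phi> (inv_into W \<theta> x)))"
    using ch(2) by (simp add: vector_atlas_def o_def)
qed


section \<open>Lie groups in coordinates\<close>

primrec lie_pow :: "('g, 'e) lie_data \<Rightarrow> 'g \<Rightarrow> nat \<Rightarrow> 'g" where
  "lie_pow L g 0 = gone L"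
| "lie_pow L g (Suc n) = gmul L g (lie_pow L g n)"

locale lie_grp =
  fixes L :: "('g::{t2_space, second_countable_topology}, 'e::euclidean_space) lie_data"
  assumes lie: "lie_group L"
begin

abbreviation mul (infixl "\<cdot>" 70) where "x \<cdot> y \<equiv> gmul L x y"
abbreviation unit ("\<one>") where "\<one> \<equiv> gone L"
abbreviation id_dom where "id_dom \<equiv> fst (id_chart L)"
abbreviation id_img where "id_img \<equiv> id_coord L ` id_dom"
abbreviation unit_coord where "unit_coord \<equiv> id_coord L \<one>"

lemma grp: "group (gmul L) (gone L) (ginv L)"
  using lie by (simp add: lie_group_def)

lemma mul_assoc: "x \<cdot> y \<cdot> z = x \<cdot> (y \<cdot> z)"
  and mul_unit [simp]: "\<one> \<cdot> x = x" "x \<cdot> \<one> = x"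
  and mul_inv [simp]: "ginv L x \<cdot> x = \<one>" "x \<cdot> ginv L x = \<one>"
proof -
  interpret group "gmul L" "gone L" "ginv L" by (rule grp)
  show "x \<cdot> y \<cdot> z = x \<cdot> (y \<cdot> z)" by (rule assoc)
  show "\<one> \<cdot> x = x" "x \<cdot> \<one> = x" "ginv L x \<cdot> x = \<one>" "x \<cdot> ginv L x = \<one>" by simp_all
qed

lemma mul_inv_cancel [simp]: "ginv L x \<cdot> (x \<cdot> y) = y" "x \<cdot> (ginv L x \<cdot> y) = y"
  by (simp_all add: mul_assoc[symmetric])

lemma mul_eq_unit_imp_inv: "x \<cdot> y = \<one> \<Longrightarrow> ginv L x = y"
  by (metis mul_inv_cancel(1) mul_unit(2))

lemma inv_inv [simp]: "ginv L (ginv L x) = x"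
  by (rule mul_eq_unit_imp_inv) simp

lemma inv_unit [simp]: "ginv L \<one> = \<one>"
  by (rule mul_eq_unit_imp_inv) simp

lemma inv_mul: "ginv L (x \<cdot> y) = ginv L y \<cdot> ginv L x"
  by (rule mul_eq_unit_imp_inv) (simp add: mul_assoc)

lemma lie_pow_add: "lie_pow L g (m + n) = lie_pow L g m \<cdot> lie_pow L g n"
  by (induction m) (simp_all add: mul_assoc)

lemma lie_pow_mult: "lie_pow L g (n * m) = lie_pow L (lie_pow L g m) n"
  by (induction n) (simp_all add: lie_pow_add)

text \<open>Needed to split a power of \<open>c0(s/m) \<cdot> c0(t/m)\<close> when the local group
  \<open>c0\<close> is extended; these two factors commute because s + t = t + s.\<close>

lemma lie_pow_mul_commute:
  assumes "g \<cdot> h = h \<cdot> g"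
  shows "lie_pow L (g \<cdot> h) n = lie_pow L g n \<cdot> lie_pow L h n"
proof (induction n)
  case (Suc n)
  have "lie_pow L g n \<cdot> h = h \<cdot> lie_pow L g n"
    by (induction n) (simp, metis assms lie_pow.simps(2) mul_assoc)
  then show ?case using Suc by simp (metis mul_assoc)
qed simp

section \<open>The chart around the identity and smoothness of the group operations\<close>

lemma atlas: "analytic_atlas (gatlas L)" "cont_atlas (gatlas L)"
  using lie by (auto simp: lie_group_def intro: analytic_imp_cont_atlas)

lemma id_chart_mem: "(id_dom, id_coord L) \<in> gatlas L"
  using lie by (simp add: lie_group_def id_coord_def)

lemma unit_in_dom [simp]: "\<one> \<in> id_dom"
  using lie by (simp add: lie_group_def)

lemma id_point_eq: "id_point L = inv_into id_dom (id_coord L)"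
  by (simp add: id_point_def id_coord_def)

lemma open_id_dom: "open id_dom" and open_id_img: "open id_img"
  using cont_atlasD[OF atlas(2) id_chart_mem] by auto

lemma id_point_id_coord [simp]: "g \<in> id_dom \<Longrightarrow> id_point L (id_coord L g) = g"
  using cont_atlasD(3)[OF atlas(2) id_chart_mem] by (simp add: id_point_eq)

lemma id_coord_id_point [simp]: "z \<in> id_img \<Longrightarrow> id_coord L (id_point L z) = z"
  by (simp add: id_point_eq f_inv_into_f)

lemma id_point_in_dom [simp]: "z \<in> id_img \<Longrightarrow> id_point L z \<in> id_dom"
  by (simp add: id_point_eq inv_into_into)

lemma smooth_id_coord: "smooth_map_on id_dom (gatlas L) vector_atlas (id_coord L)"
  by (rule smooth_map_on_chart[OF atlas(1) id_chart_mem])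

lemma smooth_id_point: "smooth_map_on id_img vector_atlas (gatlas L) (id_point L)"
  unfolding id_point_eq by (rule smooth_map_on_inv_chart[OF atlas(1) id_chart_mem])

lemma smooth_mul:
  fixes M :: "('m::topological_space, 'c::real_normed_vector) chart set"
  assumes "cont_atlas M" "smooth_map_on X M (gatlas L) f" "smooth_map_on X M (gatlas L) g"
  shows "smooth_map_on X M (gatlas L) (\<lambda>x. f x \<cdot> g x)"
proof -
  have "smooth_map_on UNIV (prod_atlas (gatlas L) (gatlas L)) (gatlas L) (\<lambda>(x, y). gmul L x y)"
    using lie by (simp add: lie_group_def analytic_imp_smooth_map)
  from smooth_map_on_compose[OF assms(1) cont_atlas_prod[OF atlas(2) atlas(2)] atlas(2)
      smooth_map_on_Pair[OF assms(1) atlas(2) atlas(2) assms(2,3)] this]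
  show ?thesis by simp
qed

lemma smooth_const_mul:
  fixes M :: "('m::topological_space, 'c::real_normed_vector) chart set"
  assumes "cont_atlas M" "smooth_map_on X M (gatlas L) f"
  shows "smooth_map_on X M (gatlas L) (\<lambda>x. g \<cdot> f x)" "smooth_map_on X M (gatlas L) (\<lambda>x. f x \<cdot> g)"
  using smooth_mul[OF assms(1) smooth_map_on_const assms(2)]
    smooth_mul[OF assms smooth_map_on_const] smooth_map_onD(1)[OF assms(2)] by auto

lemma continuous_on_mul: "continuous_on UNIV (\<lambda>(x, y). x \<cdot> y)"
  using lie by (simp add: lie_group_def regular_map_on_def)

lemma isCont_const_mul: "isCont f x \<Longrightarrow> isCont (\<lambda>x. g \<cdot> f x) x" "isCont f x \<Longrightarrow> isCont (\<lambda>x. f x \<cdot> g) x"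
  for f :: "'m::t2_space \<Rightarrow> 'g"
proof -
  have m: "isCont (\<lambda>(x, y). x \<cdot> y) p" for p
    using continuous_on_mul by (cases p) (simp add: continuous_on_eq_continuous_at)
  show "isCont (\<lambda>x. g \<cdot> f x) x" if "isCont f x"
    using isCont_o2[OF isCont_Pair[OF continuous_const that] m, of g] by simp
  show "isCont (\<lambda>x. f x \<cdot> g) x" if "isCont f x"
    using isCont_o2[OF isCont_Pair[OF that continuous_const] m, of g] by simp
qed

lemma smooth_coord_of:
  fixes f :: "'c::real_normed_vector \<Rightarrow> 'g"
  assumes "smooth_map_on X vector_atlas (gatlas L) f"
  shows "smooth_on (X \<inter> f -` id_dom) (\<lambda>z. id_coord L (f z))"
  using smooth_map_on_compose[OF cont_atlas_vector atlas(2) cont_atlas_vector assms smooth_id_coord]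
  by (simp add: smooth_map_on_vector_iff)

lemma coord_has_derivative:
  fixes f :: "'c::real_normed_vector \<Rightarrow> 'g"
  assumes "smooth_map_on X vector_atlas (gatlas L) f" "x \<in> X" "f x \<in> id_dom"
  shows "((\<lambda>z. id_coord L (f z)) has_derivative frechet_derivative (\<lambda>z. id_coord L (f z)) (at x)) (at x)"
  by (rule smooth_on_has_derivative[OF smooth_coord_of[OF assms(1)]]) (use assms in auto)

text \<open>Only the coordinates of the curve are assumed to be differentiable, so \<open>\<Phi>\<close> is
  differentiated in the chart around the identity.\<close>

lemma curve_chain:
  assumes "isCont q t" "q t \<in> id_dom"
    and q: "((\<lambda>s. id_coord L (q s)) has_vector_derivative v) (at t)"
    and \<Phi>: "((\<lambda>z. \<Phi> (id_point L z)) has_derivative \<Phi>') (at (id_coord L (q t)))"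
  shows "((\<lambda>s. \<Phi> (q s)) has_vector_derivative \<Phi>' v) (at t)"
proof -
  interpret bounded_linear \<Phi>' using \<Phi> by (rule has_derivative_bounded_linear)
  have "((\<lambda>s. \<Phi> (id_point L (id_coord L (q s)))) has_derivative (\<lambda>h. h *\<^sub>R \<Phi>' v)) (at t)"
    using has_derivative_compose[OF q[unfolded has_vector_derivative_def] \<Phi>] by (simp add: scaleR)
  moreover have "\<forall>\<^sub>F s in at t. q s \<in> id_dom"
    using topological_tendstoD[OF _ open_id_dom assms(2)] assms(1) by (simp add: isCont_def)
  then have "\<forall>\<^sub>F s in at t. \<Phi> (id_point L (id_coord L (q s))) = \<Phi> (q s)"
    by (rule eventually_mono) simp
  ultimately show ?thesis
    unfolding has_vector_derivative_def
    by (rule has_derivative_transform_eventually) (simp_all add: assms(2))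
qed

lemma id_point_line:
  fixes \<xi> :: 'e
  defines "q \<equiv> \<lambda>t. id_point L (unit_coord + t *\<^sub>R \<xi>)"
  shows "q 0 = \<one>" "isCont q 0" "((\<lambda>s. id_coord L (q s)) has_vector_derivative \<xi>) (at 0)"
proof -
  show "q 0 = \<one>" by (simp add: q_def)
  have "isCont (id_point L) (unit_coord + 0 *\<^sub>R \<xi>)"
    using smooth_map_onD(2)[OF smooth_id_point] open_id_img by (simp add: continuous_on_eq_continuous_at)
  then show "isCont q 0"
    unfolding q_def
    by (rule isCont_o2[where g = "id_point L", rotated]) (intro continuous_intros)
  have lin: "((\<lambda>t. unit_coord + t *\<^sub>R \<xi>) has_vector_derivative \<xi>) (at 0)"
    by (auto intro!: derivative_eq_intros)
  have "open ((\<lambda>t. unit_coord + t *\<^sub>R \<xi>) -` id_img)"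
    by (rule open_vimage[OF open_id_img]) (auto intro!: continuous_intros)
  then show "((\<lambda>s. id_coord L (q s)) has_vector_derivative \<xi>) (at 0)"
    by (rule has_vector_derivative_transform_within_open[OF lin]) (auto simp: q_def)
qed


end


section \<open>Left-invariant vector fields and one-parameter subgroups\<close>

context lie_grp begin

definition coord_mul :: "'e \<times> 'e \<Rightarrow> 'e" where
  "coord_mul p = id_coord L (id_point L (fst p) \<cdot> id_point L (snd p))"

text \<open>Coordinate form of the left-invariant vector field with value \<xi> at the identity: the
  multiplication is differentiated in its second argument at the identity. Being a derivative in the
  fixed direction (0, \<xi>), it inherits smoothness in z.\<close>

definition left_field :: "'e \<Rightarrow> 'e \<Rightarrow> 'e" where
  "left_field \<xi> z = frechet_derivative coord_mul (at (z, unit_coord)) (0, \<xi>)"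

lemma smooth_on_linear: "bounded_linear f \<Longrightarrow> smooth_on UNIV f"
  using bounded_linear.k_smooth_on_comp[of f UNIV _ "\<lambda>x. x"] by (simp add: smooth_on_def k_smooth_on_id)

definition coord_mul_dom :: "('e \<times> 'e) set" where
  "coord_mul_dom = (id_img \<times> id_img) \<inter> (\<lambda>p. id_point L (fst p) \<cdot> id_point L (snd p)) -` id_dom"

lemma smooth_coord_mul: "smooth_on coord_mul_dom coord_mul"
proof -
  have l: "smooth_map_on UNIV vector_atlas vector_atlas (fst :: 'e \<times> 'e \<Rightarrow> 'e)"
    "smooth_map_on UNIV vector_atlas vector_atlas (snd :: 'e \<times> 'e \<Rightarrow> 'e)"
    by (auto simp: smooth_map_on_vector_iff intro: smooth_on_linear bounded_linear_fst bounded_linear_snd)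
  have o: "open (id_img \<times> id_img)" by (simp add: open_id_img open_Times)
  have "smooth_map_on (id_img \<times> id_img) vector_atlas (gatlas L) (\<lambda>p. id_point L (fst p) \<cdot> id_point L (snd p))"
    by (intro smooth_mul cont_atlas_vector smooth_map_on_subset[OF smooth_map_on_compose[OF
            cont_atlas_vector cont_atlas_vector atlas(2) l(1) smooth_id_point] o]
          smooth_map_on_subset[OF smooth_map_on_compose[OF
            cont_atlas_vector cont_atlas_vector atlas(2) l(2) smooth_id_point] o]) auto
  from smooth_coord_of[OF this] show ?thesis by (simp add: coord_mul_dom_def coord_mul_def[abs_def])
qed

lemma coord_mul_dom_unit: "z \<in> id_img \<Longrightarrow> (z, unit_coord) \<in> coord_mul_dom"
  by (auto simp: coord_mul_dom_def)

lemma smooth_left_field: "smooth_on id_img (left_field \<xi>)"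
  unfolding left_field_def
  by (rule smooth_on_compose[OF open_id_img
        smooth_on_Pair[OF open_id_img smooth_on_id[OF open_id_img] smooth_on_const]
        smooth_on_directional[OF smooth_coord_mul]])
    (auto intro: coord_mul_dom_unit)

text \<open>Chain rule for multiplication by k. It frees \<open>left_field\<close> from its
  coordinate definition: any curve through the identity with velocity \<xi> computes it.\<close>

lemma left_field_velocity:
  assumes "k \<in> id_dom" "isCont q t" "q t = \<one>"
    "((\<lambda>s. id_coord L (q s)) has_vector_derivative \<xi>) (at t)"
  shows "((\<lambda>s. id_coord L (k \<cdot> q s)) has_vector_derivative left_field \<xi> (id_coord L k)) (at t)"
proof -
  have "(coord_mul has_derivative frechet_derivative coord_mul (at (id_coord L k, unit_coord)))
      (at (id_coord L k, unit_coord))"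
    by (rule smooth_on_has_derivative[OF smooth_coord_mul coord_mul_dom_unit]) (use assms(1) in auto)
  moreover have "((\<lambda>z. (id_coord L k, z)) has_derivative (\<lambda>v. (0, v))) (at unit_coord)"
    by (auto intro!: derivative_eq_intros)
  ultimately have "((\<lambda>z. coord_mul (id_coord L k, z)) has_derivative
      (\<lambda>v. frechet_derivative coord_mul (at (id_coord L k, unit_coord)) (0, v))) (at unit_coord)"
    by (rule has_derivative_compose[rotated])
  then have "((\<lambda>z. id_coord L (k \<cdot> id_point L z)) has_derivative (\<lambda>v. left_field v (id_coord L k))) (at unit_coord)"
    by (simp add: coord_mul_def left_field_def assms(1))
  from curve_chain[OF assms(2) _ assms(4), of "\<lambda>y. id_coord L (k \<cdot> y)"] this show ?thesis
    by (simp add: assms(3))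
qed

lemma left_field_unit: "left_field \<xi> unit_coord = \<xi>"
  using left_field_velocity[OF unit_in_dom id_point_line(2,1,3)] id_point_line(3)[of \<xi>]
  by (auto intro: vector_derivative_unique_at)

text \<open>Left translates of integral curves are integral curves. With k = q t and a test curve p,
  the velocity of g(k p(s)) = (gk)p(s) is computed twice: through the derivative A of y \<mapsto>
  gy, and through \<open>left_field_velocity\<close> at gk. Hence A carries the field at k to the
  field at gk.\<close>

lemma left_field_invariant:
  assumes "isCont q t" "q t \<in> id_dom" "g \<cdot> q t \<in> id_dom"
    and q: "((\<lambda>s. id_coord L (q s)) has_vector_derivative left_field \<xi> (id_coord L (q t))) (at t)"
  shows "((\<lambda>s. id_coord L (g \<cdot> q s)) has_vector_derivative left_field \<xi> (id_coord L (g \<cdot> q t))) (at t)"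
proof -
  define k where "k = q t"
  define p where "p s = id_point L (unit_coord + s *\<^sub>R \<xi>)" for s
  note p = id_point_line[of \<xi>, folded p_def]
  obtain A where A: "((\<lambda>z. id_coord L (g \<cdot> id_point L z)) has_derivative A) (at (id_coord L k))"
    using coord_has_derivative[OF smooth_const_mul(1)[OF cont_atlas_vector smooth_id_point], of "id_coord L k" g]
      assms(2,3) by (auto simp: k_def)
  have "((\<lambda>s. id_coord L (g \<cdot> (k \<cdot> p s))) has_vector_derivative A (left_field \<xi> (id_coord L k))) (at 0)"
    by (rule curve_chain[where \<Phi> = "\<lambda>y. id_coord L (g \<cdot> y)"])
      (use p A assms(2) k_def left_field_velocity[OF _ p(2,1,3)] in \<open>auto intro: isCont_const_mul\<close>)
  moreover have "((\<lambda>s. id_coord L (g \<cdot> k \<cdot> p s)) has_vector_derivative left_field \<xi> (id_coord L (g \<cdot> k))) (at 0)"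
    by (rule left_field_velocity) (use p assms(3) k_def in auto)
  ultimately have "A (left_field \<xi> (id_coord L k)) = left_field \<xi> (id_coord L (g \<cdot> k))"
    by (simp add: mul_assoc vector_derivative_unique_at)
  then show ?thesis
    using curve_chain[OF assms(1,2) q, of "\<lambda>y. id_coord L (g \<cdot> y)" A] A by (simp add: k_def)
qed

section \<open>Integral curves through the identity\<close>

lemma left_field_lipschitz:
  obtains r C where "r > 0" "cball unit_coord r \<subseteq> id_img" "C-lipschitz_on (cball unit_coord r) (left_field \<xi>)"
proof -
  obtain r where r: "r > 0" "cball unit_coord r \<subseteq> id_img"
    using open_id_img unit_in_dom open_contains_cball by blast
  have "k_smooth_on (Suc 0) id_img (left_field \<xi>)" using smooth_left_field by (simp add: smooth_on_def)
  from k_smooth_on_imp_lipschitz[OF this r(2)] obtain C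
    where "C-lipschitz_on (cball unit_coord r) (left_field \<xi>)" .
  then show ?thesis by (rule that[OF r])
qed

lemma coord_ball_open: "open {g \<in> id_dom. id_coord L g \<in> ball unit_coord r}"
proof -
  have "{g \<in> id_dom. id_coord L g \<in> ball unit_coord r} = id_dom \<inter> id_coord L -` ball unit_coord r"
    by auto
  then show ?thesis using smooth_map_on_open_vimage[OF smooth_id_coord] by simp
qed

lemma isCont_stays_in:
  fixes q :: "real \<Rightarrow> 'g"
  assumes "isCont q 0" "open W" "q 0 \<in> W"
  obtains d where "d > 0" "\<And>t. \<bar>t\<bar> < d \<Longrightarrow> q t \<in> W"
proof -
  have "\<forall>\<^sub>F t in at 0. q t \<in> W"
    using topological_tendstoD[of q "q 0" "at 0" W] assms by (simp add: isCont_def)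
  then obtain d where d: "d > 0" "\<And>t. t \<noteq> 0 \<Longrightarrow> dist t 0 < d \<Longrightarrow> q t \<in> W"
    by (auto simp: eventually_at)
  show ?thesis
  proof (rule that[OF d(1)])
    show "q t \<in> W" if "\<bar>t\<bar> < d" for t
      using d(2)[of t] that assms(3) by (cases "t = 0") (auto simp: dist_norm)
  qed
qed

lemma local_one_param_subgroup:
  obtains \<delta> and c :: "real \<Rightarrow> 'g" where "\<delta> > 0" "c 0 = \<one>"
    "\<And>s t. \<bar>s\<bar> < \<delta> \<Longrightarrow> \<bar>t\<bar> < \<delta> \<Longrightarrow> c (s + t) = c s \<cdot> c t"
    "smooth_map_on {-\<delta><..<\<delta>} vector_atlas (gatlas L) c"
    "((\<lambda>t. id_coord L (c t)) has_vector_derivative \<xi>) (at 0)"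
proof -
  obtain r C where r: "r > 0" "cball unit_coord r \<subseteq> id_img"
    and C: "C-lipschitz_on (cball unit_coord r) (left_field \<xi>)"
    by (rule left_field_lipschitz)
  obtain T x where T: "T > 0" and x0: "x 0 = unit_coord"
    and x: "\<And>t. \<bar>t\<bar> < T \<Longrightarrow> x t \<in> cball unit_coord r \<and> (x has_vector_derivative left_field \<xi> (x t)) (at t)"
    using ode_local_solution[OF C r(1)] by metis
  have x_img: "x t \<in> id_img" if "\<bar>t\<bar> < T" for t using x[OF that] r(2) by blast
  \<comment> \<open>Bootstrapping: the derivative of x is the smooth field evaluated along x, hence
    as smooth as x itself, and each pass gains one order.\<close>
  have "k_smooth_on n {-T<..<T} x" for n
  proof (induction n)
    case 0
    have "continuous_on {-T<..<T} x"
      by (intro continuous_at_imp_continuous_on ballI has_vector_derivative_continuous[OF x[THEN conjunct2]]) auto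
    then show ?case by simp
  next
    case (Suc n)
    show ?case
    proof (rule k_smooth_on_SucI[where f' = "\<lambda>t v. v *\<^sub>R left_field \<xi> (x t)"])
      show "(x has_derivative (\<lambda>v. v *\<^sub>R left_field \<xi> (x t))) (at t)" if "t \<in> {-T<..<T}" for t
        using x[of t] that by (simp add: has_vector_derivative_def abs_less_iff)
      have "k_smooth_on n {-T<..<T} (\<lambda>t. left_field \<xi> (x t))"
        by (rule k_smooth_on_compose[OF _ Suc smooth_left_field[unfolded smooth_on_def, rule_format]])
          (use x_img in auto)
      then show "k_smooth_on n {-T<..<T} (\<lambda>t. v *\<^sub>R left_field \<xi> (x t))" for v
        by (intro bounded_linear.k_smooth_on_comp[OF bounded_linear_scaleR_right]) auto
    qed simp
  qed
  then have "smooth_map_on {-T<..<T} vector_atlas vector_atlas x"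
    by (simp add: smooth_map_on_vector_iff smooth_on_def)
  from smooth_map_on_compose[OF cont_atlas_vector cont_atlas_vector atlas(2) this smooth_id_point]
  have "smooth_map_on ({-T<..<T} \<inter> x -` id_img) vector_atlas (gatlas L) (\<lambda>t. id_point L (x t))" .
  moreover have "{-T<..<T} \<inter> x -` id_img = {-T<..<T}" using x_img by auto
  ultimately have sm: "smooth_map_on {-T<..<T} vector_atlas (gatlas L) (\<lambda>t. id_point L (x t))" by simp
  define c where "c t = id_point L (x t)" for t
  note sm = sm[folded c_def]
  have c_dom: "c t \<in> id_dom" and c_coord: "id_coord L (c t) = x t" if "\<bar>t\<bar> < T" for t
    using x_img[OF that] by (simp_all add: c_def)
  have c0: "c 0 = \<one>" by (simp add: c_def x0)
  have c_cont: "isCont c t" if "\<bar>t\<bar> < T" for t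
    using smooth_map_onD(2)[OF sm] that by (simp add: continuous_on_eq_continuous_at abs_less_iff)
  have c_vel: "((\<lambda>t. id_coord L (c t)) has_vector_derivative left_field \<xi> (x t)) (at t)" if "\<bar>t\<bar> < T" for t
    by (rule has_vector_derivative_transform_within_open[of x _ _ "{-T<..<T}"])
      (use x[OF that] that c_coord in auto)
  define B where "B = {g \<in> id_dom. id_coord L g \<in> ball unit_coord r}"
  \<comment> \<open>Uniqueness needs the products c s \<cdot> c u to stay in the ball where the
    field is Lipschitz; continuity of the multiplication at the identity supplies W1 and W2 for
    this.\<close>
  have "open ((\<lambda>(x, y). x \<cdot> y) -` B)"
    using coord_ball_open[of r] continuous_on_mul by (intro open_vimage) (simp_all add: B_def)
  moreover have "(\<one>, \<one>) \<in> (\<lambda>(x, y). x \<cdot> y) -` B" using r(1) by (simp add: B_def)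
  ultimately obtain W1 W2 where W: "open W1" "open W2" "\<one> \<in> W1" "\<one> \<in> W2" "W1 \<times> W2 \<subseteq> (\<lambda>(x, y). x \<cdot> y) -` B"
    by (auto elim!: open_prod_elim)
  obtain d where d: "d > 0" "\<And>t. \<bar>t\<bar> < d \<Longrightarrow> c t \<in> W1 \<inter> W2"
    using isCont_stays_in[of c "W1 \<inter> W2"] c_cont[of 0] T W(1-4) c0 by auto
  \<comment> \<open>Half of T, so that s + u remains in the interval of existence.\<close>
  define \<delta> where "\<delta> = min d (T / 2)"
  have \<delta>: "\<delta> > 0" "\<delta> \<le> T / 2" "\<And>t. \<bar>t\<bar> < \<delta> \<Longrightarrow> c t \<in> W1 \<inter> W2"
    using d T by (auto simp: \<delta>_def)
  have hom: "c (s + t) = c s \<cdot> c t" if s: "\<bar>s\<bar> < \<delta>" and t: "\<bar>t\<bar> < \<delta>" for s t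
  proof -
    have prod_in: "c s \<cdot> c u \<in> B" if "\<bar>u\<bar> < \<delta>" for u
      using W(5) \<delta>(3)[OF s] \<delta>(3)[OF that] by auto
    have "x (s + t) = id_coord L (c s \<cdot> c t)"
    \<comment> \<open>For fixed s, both u \<mapsto> c(s + u) and u \<mapsto> c s \<cdot> c u are
      integral curves that start at c s.\<close>
    proof (rule ode_unique[OF C _ t])
      show "x (s + 0) = id_coord L (c s \<cdot> c 0)"
        using c_coord[of s] s \<delta> T by (simp add: c0)
      fix u assume u: "\<bar>u\<bar> < \<delta>"
      have su: "\<bar>s + u\<bar> < T" using s u \<delta>(2) by linarith
      have "((\<lambda>u. s + u) has_vector_derivative 1) (at u)"
        by (auto intro!: derivative_eq_intros)
      from vector_diff_chain_at[OF this, of x] x[OF su]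
      show "x (s + u) \<in> cball unit_coord r \<and> ((\<lambda>u. x (s + u)) has_vector_derivative left_field \<xi> (x (s + u))) (at u)"
        by (simp add: o_def)
      have uT: "\<bar>u\<bar> < T" using u \<delta>(2) T by linarith
      have "((\<lambda>u. id_coord L (c s \<cdot> c u)) has_vector_derivative left_field \<xi> (id_coord L (c s \<cdot> c u))) (at u)"
        by (rule left_field_invariant)
          (use c_cont c_dom c_vel c_coord uT prod_in[OF u] in \<open>auto simp: B_def\<close>)
      then show "id_coord L (c s \<cdot> c u) \<in> cball unit_coord r \<and>
          ((\<lambda>u. id_coord L (c s \<cdot> c u)) has_vector_derivative left_field \<xi> (id_coord L (c s \<cdot> c u))) (at u)"
        using prod_in[OF u] by (simp add: B_def)
    qed
    then show ?thesis using prod_in[OF t] by (simp add: c_def[of "s + t"] B_def)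
  qed
  show ?thesis
  proof (rule that[OF \<delta>(1) c0 hom])
    show "smooth_map_on {-\<delta><..<\<delta>} vector_atlas (gatlas L) c"
      by (rule smooth_map_on_subset[OF sm]) (use \<delta> T in auto)
    show "((\<lambda>t. id_coord L (c t)) has_vector_derivative \<xi>) (at 0)"
      using c_vel[of 0] T by (simp add: x0 left_field_unit)
  qed
qed

text \<open>Only the total time has to be small, since all smaller multiples of u are then small as
  well. For a global homomorphism any \<delta> beyond the total time serves.\<close>

lemma lie_pow_local_hom:
  fixes c :: "real \<Rightarrow> 'g"
  assumes "c 0 = \<one>" "\<And>s t. \<bar>s\<bar> < \<delta> \<Longrightarrow> \<bar>t\<bar> < \<delta> \<Longrightarrow> c (s + t) = c s \<cdot> c t"
    and "\<bar>real n * u\<bar> < \<delta>"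
  shows "c (real n * u) = lie_pow L (c u) n"
  using assms(3)
proof (induction n)
  case 0
  then show ?case by (simp add: assms(1))
next
  case (Suc n)
  have le: "\<bar>u\<bar> \<le> \<bar>real (Suc n) * u\<bar>" "\<bar>real n * u\<bar> \<le> \<bar>real (Suc n) * u\<bar>"
    using mult_right_mono[of 1 "real (Suc n)" "\<bar>u\<bar>"] mult_right_mono[of "real n" "real (Suc n)" "\<bar>u\<bar>"]
    by (simp_all add: abs_mult)
  have "c (u + real n * u) = c u \<cdot> c (real n * u)"
    by (rule assms(2)) (use le Suc.prems in linarith)+
  then show ?case using Suc.IH le(2) Suc.prems by (simp add: algebra_simps)
qed

lemma one_param_subgroupD:
  assumes "one_param_subgroup L \<xi> c"
  shows "c 0 = \<one>" "c (s + t) = c s \<cdot> c t" "isCont c t" "c (- t) = ginv L (c t)"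
    "smooth_map_on UNIV vector_atlas (gatlas L) c"
    "((\<lambda>t. id_coord L (c t)) has_vector_derivative \<xi>) (at 0)"
proof -
  have hom: "c (s + t) = c s \<cdot> c t" for s t using assms by (simp add: one_param_subgroup_def)
  then show "c (s + t) = c s \<cdot> c t" .
  show c0: "c 0 = \<one>"
    using hom[of 0 0] by (metis add_0 mul_inv(1) mul_inv_cancel(1))
  show "c (- t) = ginv L (c t)"
    using hom[of t "- t"] mul_eq_unit_imp_inv[of "c t" "c (- t)"] by (simp add: c0)
  show sm: "smooth_map_on UNIV vector_atlas (gatlas L) c"
    using assms by (simp add: one_param_subgroup_def)
  show "isCont c t" using smooth_map_onD(2)[OF sm] by (simp add: continuous_on_eq_continuous_at)
  show "((\<lambda>t. id_coord L (c t)) has_vector_derivative \<xi>) (at 0)"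
    using assms by (simp add: one_param_subgroup_def has_left_velocity_def c0)
qed

lemma one_param_subgroupI:
  assumes "c 0 = \<one>" "\<And>s t. c (s + t) = c s \<cdot> c t"
    "smooth_map_on UNIV vector_atlas (gatlas L) c"
    "((\<lambda>t. id_coord L (c t)) has_vector_derivative \<xi>) (at 0)"
  shows "one_param_subgroup L \<xi> c"
  using assms by (simp add: one_param_subgroup_def has_left_velocity_def)

lemma ex_one_param_subgroup: "\<exists>c. one_param_subgroup L \<xi> c"
proof -
  obtain \<delta> and c0 :: "real \<Rightarrow> 'g" where \<delta>: "\<delta> > 0" and c0: "c0 0 = \<one>"
    and hom: "\<And>s t. \<bar>s\<bar> < \<delta> \<Longrightarrow> \<bar>t\<bar> < \<delta> \<Longrightarrow> c0 (s + t) = c0 s \<cdot> c0 t"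
    and sm: "smooth_map_on {-\<delta><..<\<delta>} vector_atlas (gatlas L) c0"
    and vel: "((\<lambda>t. id_coord L (c0 t)) has_vector_derivative \<xi>) (at 0)"
    using local_one_param_subgroup by metis
  \<comment> \<open>Chosen so that |t| / n t < \<delta>; the successor makes the inequality strict
    and the number positive.\<close>
  define n where "n t = Suc (nat \<lceil>\<bar>t\<bar> / \<delta>\<rceil>)" for t :: real
  define c where "c t = lie_pow L (c0 (t / n t)) (n t)" for t
  have n: "\<bar>t\<bar> < real (n t) * \<delta>" for t
  proof -
    have "\<bar>t\<bar> / \<delta> < real (n t)" unfolding n_def by linarith
    then show ?thesis using \<delta> by (simp add: pos_divide_less_eq)
  qed
  \<comment> \<open>Refining m to m k does not change the power. Two admissible numbers are compared
    through their product, so c does not depend on the choice of \<open>n\<close>.\<close>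
  have indep: "lie_pow L (c0 (t / real (m * k))) (m * k) = lie_pow L (c0 (t / real m)) m"
    if "\<bar>t\<bar> < real m * \<delta>" "k > 0" "m > 0" for t m k
  proof -
    have "c0 (real k * (t / real (m * k))) = lie_pow L (c0 (t / real (m * k))) k"
      by (rule lie_pow_local_hom[where \<delta> = \<delta>]) (use c0 hom that in \<open>auto simp: field_simps abs_mult\<close>)
    then show ?thesis using that by (simp add: lie_pow_mult)
  qed
  have c: "c t = lie_pow L (c0 (t / real m)) m" if "\<bar>t\<bar> < real m * \<delta>" "m > 0" for t m
    using indep[OF n[of t] that(2)] indep[OF that(1), of "n t"] that(2)
    by (simp add: c_def n_def mult.commute)
  have c_local: "c t = c0 t" if "\<bar>t\<bar> < \<delta>" for t using c[of t 1] that by simp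
  have c_hom: "c (s + t) = c s \<cdot> c t" for s t
  proof -
    \<comment> \<open>One number of steps that is admissible for s, t and s + t
      simultaneously.\<close>
    define m where "m = max (n (s + t)) (max (n s) (n t))"
    have m: "real (n u) \<le> real m" if "u \<in> {s + t, s, t}" for u
      using that unfolding m_def of_nat_le_iff by auto
    have m0: "m > 0" by (simp add: m_def n_def)
    have b: "\<bar>u\<bar> < real m * \<delta>" if "u \<in> {s + t, s, t}" for u
      using n[of u] mult_right_mono[OF m[OF that], of \<delta>] \<delta> by linarith
    have "\<bar>s / real m\<bar> < \<delta>" "\<bar>t / real m\<bar> < \<delta>"
      using b m0 by (auto simp: field_simps)
    note h = hom[OF this] hom[OF this(2,1)]
    have sum: "c0 ((s + t) / real m) = c0 (s / real m) \<cdot> c0 (t / real m)"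
      using h(1) by (simp add: add_divide_distrib)
    have comm: "c0 (s / real m) \<cdot> c0 (t / real m) = c0 (t / real m) \<cdot> c0 (s / real m)"
      using h by (simp add: add.commute)
    have "c u = lie_pow L (c0 (u / real m)) m" if "u \<in> {s + t, s, t}" for u
      by (rule c[OF b[OF that] m0])
    then show ?thesis using lie_pow_mul_commute[OF comm, of m] by (simp add: sum)
  qed
  have "one_param_subgroup L \<xi> c"
  proof (rule one_param_subgroupI[OF _ c_hom])
    show "c 0 = \<one>" using c_local[of 0] \<delta> by (simp add: c0)
    show "((\<lambda>t. id_coord L (c t)) has_vector_derivative \<xi>) (at 0)"
      by (rule has_vector_derivative_transform_within_open[OF vel, of "{-\<delta><..<\<delta>}"])
        (use \<delta> c_local in auto)
    show "smooth_map_on UNIV vector_atlas (gatlas L) c"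
    proof (rule smooth_map_on_local[OF cont_atlas_vector _ open_UNIV atlas(2)])
      fix t0 :: real
      \<comment> \<open>Near t0 the curve is the translate c(t) = c(t0) c0(t - t0) of the smooth
        local piece.\<close>
      have sh: "smooth_map_on UNIV vector_atlas vector_atlas (\<lambda>t. - t0 + t *\<^sub>R 1)"
        by (simp only: smooth_map_on_vector_iff open_UNIV smooth_on_affine_curve simp_thms)
      have "smooth_map_on (UNIV \<inter> (\<lambda>t. - t0 + t *\<^sub>R 1) -` {-\<delta><..<\<delta>}) vector_atlas (gatlas L) (\<lambda>t. c0 (- t0 + t *\<^sub>R 1))"
        by (rule smooth_map_on_compose[OF cont_atlas_vector cont_atlas_vector atlas(2) sh sm])
      from smooth_const_mul(1)[OF cont_atlas_vector this, of "c t0"]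
      have "smooth_map_on {t0 - \<delta><..<t0 + \<delta>} vector_atlas (gatlas L) (\<lambda>t. c t0 \<cdot> c0 (- t0 + t *\<^sub>R 1))"
        by (rule smooth_map_on_subset) auto
      moreover have "c t0 \<cdot> c0 (- t0 + t *\<^sub>R 1) = c t" if "t \<in> {t0 - \<delta><..<t0 + \<delta>}" for t
        using c_hom[of t0 "- t0 + t"] c_local[of "- t0 + t"] that by auto
      ultimately have "smooth_map_on {t0 - \<delta><..<t0 + \<delta>} vector_atlas (gatlas L) c"
        by (rule smooth_map_on_cong[OF cont_atlas_vector atlas(2)])
      then show "\<exists>Y. t0 \<in> Y \<and> smooth_map_on Y vector_atlas (gatlas L) c"
        using \<delta> by (intro exI[of _ "{t0 - \<delta><..<t0 + \<delta>}"]) auto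
    qed
  qed
  then show ?thesis by blast
qed

text \<open>From c(s) = c(t) c(s - t), left translation carries the velocity at 0 to time t; so c is
  an integral curve wherever it lies in the chart.\<close>

lemma one_param_subgroup_velocity:
  assumes c: "one_param_subgroup L \<xi> c" and "c t \<in> id_dom"
  shows "((\<lambda>s. id_coord L (c s)) has_vector_derivative left_field \<xi> (id_coord L (c t))) (at t)"
proof -
  note cD = one_param_subgroupD[OF c]
  have "((\<lambda>s. s - t) has_vector_derivative 1) (at t)" by (auto intro!: derivative_eq_intros)
  moreover have "((\<lambda>s. id_coord L (c t \<cdot> c s)) has_vector_derivative left_field \<xi> (id_coord L (c t))) (at (t - t))"
    using left_field_velocity[OF assms(2) cD(3,1,6)] by simp
  ultimately have "(((\<lambda>s. id_coord L (c t \<cdot> c s)) \<circ> (\<lambda>s. s - t)) has_vector_derivative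
      1 *\<^sub>R left_field \<xi> (id_coord L (c t))) (at t)"
    by (rule vector_diff_chain_at)
  then show ?thesis by (simp add: o_def cD(2)[symmetric])
qed

text \<open>Close to 0 both curves solve the same equation inside the Lipschitz ball. For arbitrary
  t, equality at t/n is raised to the n-th power.\<close>

lemma one_param_subgroup_unique:
  assumes c: "one_param_subgroup L \<xi> c" and c': "one_param_subgroup L \<xi> c'"
  shows "c = c'"
proof
  fix t
  note cD = one_param_subgroupD[OF c] and c'D = one_param_subgroupD[OF c']
  obtain r C where r: "r > 0" "cball unit_coord r \<subseteq> id_img"
    and C: "C-lipschitz_on (cball unit_coord r) (left_field \<xi>)"
    by (rule left_field_lipschitz)
  define B where "B = {g \<in> id_dom. id_coord L g \<in> ball unit_coord r}"
  have B: "open B" "\<one> \<in> B" using coord_ball_open[of r] r(1) by (auto simp: B_def)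
  obtain d where d: "d > 0" "\<And>t. \<bar>t\<bar> < d \<Longrightarrow> c t \<in> B"
    using isCont_stays_in[OF cD(3) B(1)] cD(1) B(2) by metis
  obtain d' where d': "d' > 0" "\<And>t. \<bar>t\<bar> < d' \<Longrightarrow> c' t \<in> B"
    using isCont_stays_in[OF c'D(3) B(1)] c'D(1) B(2) by metis
  define \<delta> where "\<delta> = min d d'"
  have \<delta>: "\<delta> > 0" "\<And>t. \<bar>t\<bar> < \<delta> \<Longrightarrow> c t \<in> B" "\<And>t. \<bar>t\<bar> < \<delta> \<Longrightarrow> c' t \<in> B"
    using d d' by (auto simp: \<delta>_def)
  have loc: "c u = c' u" if u: "\<bar>u\<bar> < \<delta>" for u
  proof -
    have "id_coord L (c u) = id_coord L (c' u)"
      by (rule ode_unique[OF C _ u])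
        (use cD(1) c'D(1) \<delta>(2,3) one_param_subgroup_velocity[OF c] one_param_subgroup_velocity[OF c']
          in \<open>auto simp: B_def less_imp_le\<close>)
    then show ?thesis using \<delta>(2,3)[OF u] by (metis (no_types, lifting) B_def id_point_id_coord mem_Collect_eq)
  qed
  obtain n :: nat where n: "n > 0" "\<bar>t\<bar> / \<delta> < real n"
    using reals_Archimedean2[of "max 1 (\<bar>t\<bar> / \<delta>)"] by (metis less_trans max_less_iff_conj of_nat_0_less_iff zero_less_one)
  have pow: "z t = lie_pow L (z (t / real n)) n" if "one_param_subgroup L \<xi> z" for z
    using lie_pow_local_hom[of z "\<bar>t\<bar> + 1" n "t / real n"] one_param_subgroupD(1,2)[OF that] n(1) by simp
  have "\<bar>t / real n\<bar> < \<delta>" using n \<delta>(1) by (simp add: field_simps)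
  then show "c t = c' t" using pow[OF c] pow[OF c'] loc by simp
qed

lemma one_param_subgroup_scaleR:
  assumes c: "one_param_subgroup L \<xi> c"
  shows "one_param_subgroup L (u *\<^sub>R \<xi>) (\<lambda>t. c (t * u))"
proof (rule one_param_subgroupI)
  note cD = one_param_subgroupD[OF c]
  have "smooth_map_on UNIV vector_atlas vector_atlas (\<lambda>t. 0 + t *\<^sub>R u)"
    by (simp only: smooth_map_on_vector_iff open_UNIV smooth_on_affine_curve simp_thms)
  from smooth_map_on_compose[OF cont_atlas_vector cont_atlas_vector atlas(2) this cD(5)]
  show "smooth_map_on UNIV vector_atlas (gatlas L) (\<lambda>t. c (t * u))" by simp
  have "((\<lambda>t. t * u) has_vector_derivative u) (at 0)" by (auto intro!: derivative_eq_intros)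
  from vector_diff_chain_at[OF this, of "\<lambda>t. id_coord L (c t)" \<xi>] cD(6)
  show "((\<lambda>t. id_coord L (c (t * u))) has_vector_derivative u *\<^sub>R \<xi>) (at 0)" by (simp add: o_def)
qed (simp_all add: one_param_subgroupD(1,2)[OF c] distrib_right)

lemma one_param_subgroup_uminus:
  "one_param_subgroup L \<xi> c \<Longrightarrow> one_param_subgroup L (- \<xi>) (\<lambda>t. c (- t))"
  using one_param_subgroup_scaleR[of \<xi> c "-1"] by simp

text \<open>Uniqueness makes the definite description in \<open>lie_exp\<close> denote t \<mapsto>
  c(t u), whose value at 1 is c u.\<close>

lemma lie_exp_scaleR:
  assumes "one_param_subgroup L \<xi> c"
  shows "lie_exp L (u *\<^sub>R \<xi>) = c u"
proof -
  have "(THE c. one_param_subgroup L (u *\<^sub>R \<xi>) c) = (\<lambda>t. c (t * u))"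
    using one_param_subgroup_scaleR[OF assms] one_param_subgroup_unique by blast
  then show ?thesis by (simp add: lie_exp_def)
qed

section \<open>Conjugation and the adjoint map\<close>

lemma coord_conj_has_derivative:
  "((\<lambda>z. id_coord L (g \<cdot> id_point L z \<cdot> ginv L g)) has_derivative Ad L g) (at unit_coord)"
  unfolding Ad_def
  by (rule coord_has_derivative[OF smooth_const_mul(2)[OF cont_atlas_vector
          smooth_const_mul(1)[OF cont_atlas_vector smooth_id_point]]]) auto

lemma linear_Ad: "linear (Ad L g)"
  using has_derivative_linear[OF coord_conj_has_derivative] .

lemma one_param_subgroup_conj:
  assumes c: "one_param_subgroup L \<xi> c"
  shows "one_param_subgroup L (Ad L g \<xi>) (\<lambda>t. g \<cdot> c t \<cdot> ginv L g)"
proof (rule one_param_subgroupI)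
  note cD = one_param_subgroupD[OF c]
  show "smooth_map_on UNIV vector_atlas (gatlas L) (\<lambda>t. g \<cdot> c t \<cdot> ginv L g)"
    by (intro smooth_const_mul cont_atlas_vector cD)
  show "((\<lambda>t. id_coord L (g \<cdot> c t \<cdot> ginv L g)) has_vector_derivative Ad L g \<xi>) (at 0)"
    by (rule curve_chain[where \<Phi> = "\<lambda>y. id_coord L (g \<cdot> y \<cdot> ginv L g)"])
      (use cD(1,3,6) coord_conj_has_derivative in auto)
qed (simp_all add: one_param_subgroupD(1,2)[OF c] mul_assoc)

end


section \<open>Dual maps and the cotangent-lift momentum map\<close>

lemma blinfun_apply_dual_map:
  fixes T :: "'a::euclidean_space \<Rightarrow> 'b::real_normed_vector"
  assumes "linear T"
  shows "blinfun_apply (dual_map T \<mu>) v = blinfun_apply \<mu> (T v)"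
proof -
  have "linear (blinfun_apply \<mu> \<circ> T)"
    using assms by (intro linear_compose bounded_linear.linear[OF blinfun.bounded_linear_right])
  then have "bounded_linear (\<lambda>v. blinfun_apply \<mu> (T v))"
    by (simp add: o_def linear_conv_bounded_linear)
  then show ?thesis by (simp add: dual_map_def bounded_linear_Blinfun_apply)
qed

lemma blinfun_apply_flat: "blinfun_apply (flat u) v = u \<bullet> v"
  by (simp add: flat_def bounded_linear_Blinfun_apply bounded_linear_inner_right)

context lie_grp begin

text \<open>Smoothness of the action is stated in product charts. Fixing J in the chart
  \<open>id_dom \<times> UNIV\<close> leaves a differentiable map of the group coordinate.\<close>

lemma act_has_derivative:
  assumes "left_representation L act"
  obtains B where "((\<lambda>z. act (id_point L z) J) has_derivative B) (at unit_coord)"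
proof -
  have sm: "smooth_map_on UNIV (prod_atlas (gatlas L) vector_atlas) vector_atlas (\<lambda>(g, I). act g I)"
    using assms by (simp add: left_representation_def)
  have ch: "(id_dom \<times> UNIV, map_prod (id_coord L) id) \<in> prod_atlas (gatlas L) vector_atlas"
    using id_chart_mem by (auto simp: prod_atlas_def vector_atlas_def)
  define f where "f p = (\<lambda>(g, I). act g I) (inv_into (id_dom \<times> UNIV) (map_prod (id_coord L) id) p)" for p
  have "smooth_on (map_prod (id_coord L) id ` (id_dom \<times> UNIV)) f"
    using smooth_map_onD(3)[OF sm ch, of UNIV id] by (simp add: f_def[abs_def] vector_atlas_def)
  then have "(f has_derivative frechet_derivative f (at (unit_coord, J))) (at (unit_coord, J))"
    by (rule smooth_on_has_derivative) (auto intro!: image_eqI[of _ _ "(\<one>, J)"])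
  moreover have "((\<lambda>z. (z, J)) has_derivative (\<lambda>v. (v, 0))) (at unit_coord)"
    by (auto intro!: derivative_eq_intros)
  ultimately have d: "((\<lambda>z. f (z, J)) has_derivative (\<lambda>v. frechet_derivative f (at (unit_coord, J)) (v, 0))) (at unit_coord)"
    by (rule has_derivative_compose[rotated])
  have e: "f (z, J) = act (id_point L z) J" if "z \<in> id_img" for z
    using that cont_atlasD(3)[OF atlas(2) id_chart_mem]
    by (simp add: f_def inv_into_map_prod id_point_eq)
  have "((\<lambda>z. act (id_point L z) J) has_derivative
      (\<lambda>v. frechet_derivative f (at (unit_coord, J)) (v, 0))) (at unit_coord)"
    by (rule has_derivative_transform_within_open[OF d open_id_img]) (simp_all add: e)
  then show ?thesis by (rule that)
qed

text \<open>Let B be the derivative of g \<mapsto> gJ at the identity in coordinates. Every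
  one-parameter subgroup with velocity \<xi>, the exponential included, moves J with velocity B
  \<xi>; this gives linearity in \<xi> at the same time.\<close>

lemma
  assumes "left_representation L act"
  shows act_one_param_subgroup: "one_param_subgroup L \<xi> c \<Longrightarrow>
      ((\<lambda>t. act (c t) J) has_vector_derivative inf_generator L act \<xi> J) (at 0)"
    and linear_inf_generator: "linear (\<lambda>\<xi>. inf_generator L act \<xi> J)"
proof -
  obtain B where B: "((\<lambda>z. act (id_point L z) J) has_derivative B) (at unit_coord)"
    using act_has_derivative[OF assms] .
  have c: "((\<lambda>t. act (c t) J) has_vector_derivative B \<xi>) (at 0)" if "one_param_subgroup L \<xi> c" for \<xi> c
    by (rule curve_chain[where \<Phi> = "\<lambda>g. act g J"])
      (use one_param_subgroupD[OF that] B in auto)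
  have gen: "inf_generator L act \<xi> J = B \<xi>" for \<xi>
  proof -
    obtain c where "one_param_subgroup L \<xi> c" using ex_one_param_subgroup by blast
    with c[OF this] show ?thesis
      by (simp add: inf_generator_def lie_exp_scaleR vector_derivative_at)
  qed
  show "((\<lambda>t. act (c t) J) has_vector_derivative inf_generator L act \<xi> J) (at 0)" if "one_param_subgroup L \<xi> c"
    using c[OF that] by (simp add: gen)
  show "linear (\<lambda>\<xi>. inf_generator L act \<xi> J)"
    using has_derivative_linear[OF B] by (simp add: gen)
qed

text \<open>\<open>Blinfun\<close> is meaningful only for bounded linear maps; linearity of the
  generator in \<xi> provides this.\<close>

lemma blinfun_apply_diamond:
  assumes "left_representation L act"
  shows "blinfun_apply (diamond L act J \<omega>) \<xi> = blinfun_apply \<omega> (inf_generator L act \<xi> J)"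
  using blinfun_apply_dual_map[OF linear_inf_generator[OF assms], of J \<omega> \<xi>]
  by (simp add: diamond_def dual_map_def)


section \<open>The map \<tau> and its right-trivialised differential\<close>

lemma exp_approxD:
  assumes "exp_approx L D \<tau>"
  shows "open D" "open (\<tau> ` D)" "inj_on \<tau> D" "smooth_map_on D vector_atlas (gatlas L) \<tau>"
    "smooth_map_on (\<tau> ` D) (gatlas L) vector_atlas (inv_into D \<tau>)"
    "\<eta> \<in> D \<Longrightarrow> - \<eta> \<in> D \<Longrightarrow> \<tau> (- \<eta>) = ginv L (\<tau> \<eta>)"
proof -
  show "open D" "open (\<tau> ` D)" "inj_on \<tau> D" "smooth_map_on D vector_atlas (gatlas L) \<tau>"
    "smooth_map_on (\<tau> ` D) (gatlas L) vector_atlas (inv_into D \<tau>)"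
    using assms by (auto simp: exp_approx_def analytic_diffeo_def bij_betw_def analytic_imp_smooth_map)
  assume "\<eta> \<in> D" "- \<eta> \<in> D"
  then have "\<tau> (- \<eta>) \<cdot> \<tau> \<eta> = \<one>" using assms by (simp add: exp_approx_def)
  then show "\<tau> (- \<eta>) = ginv L (\<tau> \<eta>)" by (metis mul_eq_unit_imp_inv inv_inv)
qed

text \<open>Put \<open>y t = \<tau>\<^sup>-\<^sup>1(\<tau>(\<eta>) c(t))\<close>. Then \<open>\<tau>(- y t) \<tau>(- \<eta>)\<^sup>-\<^sup>1 = c(- t)\<close>, so the right-trivialised
  differential of \<open>\<tau>\<close> at \<open>- \<eta>\<close> maps \<open>y'(0)\<close> to the velocity of \<open>c\<close>.\<close>

lemma
  assumes \<tau>: "exp_approx L D \<tau>" and \<eta>: "\<eta> \<in> D" "- \<eta> \<in> D"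
  shows retraction_inv_velocity: "one_param_subgroup L \<zeta> c \<Longrightarrow>
      ((\<lambda>t. inv_into D \<tau> (\<tau> \<eta> \<cdot> c t)) has_vector_derivative dtau_inv L \<tau> (- \<eta>) \<zeta>) (at 0)"
    and linear_dtau_inv: "linear (dtau_inv L \<tau> (- \<eta>))"
proof -
  note \<tau>D = exp_approxD[OF \<tau>]
  let ?\<sigma> = "inv_into D \<tau>" and ?d = "dtau L \<tau> (- \<eta>)"
  have "smooth_map_on (id_img \<inter> (\<lambda>z. \<tau> \<eta> \<cdot> id_point L z) -` \<tau> ` D) vector_atlas vector_atlas
      (\<lambda>z. ?\<sigma> (\<tau> \<eta> \<cdot> id_point L z))"
    by (rule smooth_map_on_compose[OF cont_atlas_vector atlas(2) cont_atlas_vector _ \<tau>D(5)])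
      (intro smooth_const_mul cont_atlas_vector smooth_id_point)
  then have "smooth_on (id_img \<inter> (\<lambda>z. \<tau> \<eta> \<cdot> id_point L z) -` \<tau> ` D) (\<lambda>z. ?\<sigma> (\<tau> \<eta> \<cdot> id_point L z))"
    by (simp add: smooth_map_on_vector_iff)
  from smooth_on_has_derivative[OF this, of unit_coord] obtain Q where
    Q: "((\<lambda>z. ?\<sigma> (\<tau> \<eta> \<cdot> id_point L z)) has_derivative Q) (at unit_coord)"
    using \<eta>(1) by auto
  have "((\<lambda>\<zeta>. id_coord L (\<tau> \<zeta> \<cdot> ginv L (\<tau> (- \<eta>)))) has_derivative ?d) (at (- \<eta>))"
    unfolding dtau_def
    by (rule coord_has_derivative[OF smooth_const_mul(2)[OF cont_atlas_vector \<tau>D(4)]]) (use \<eta> in auto)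
  then have d: "((\<lambda>\<zeta>. id_coord L (\<tau> \<zeta> \<cdot> \<tau> \<eta>)) has_derivative ?d) (at (- \<eta>))"
    using \<tau>D(6)[OF \<eta>] by simp
  then have lin: "linear ?d" by (rule has_derivative_linear)
  have vel: "((\<lambda>t. ?\<sigma> (\<tau> \<eta> \<cdot> c t)) has_vector_derivative Q \<zeta>) (at 0)"
    if "one_param_subgroup L \<zeta> c" for \<zeta> c
    by (rule curve_chain[where \<Phi> = "\<lambda>g. ?\<sigma> (\<tau> \<eta> \<cdot> g)"])
      (use one_param_subgroupD[OF that] Q in auto)
  have dQ: "?d (Q \<zeta>) = \<zeta>" for \<zeta>
  proof -
    obtain c where c: "one_param_subgroup L \<zeta> c" using ex_one_param_subgroup by blast
    note cD = one_param_subgroupD[OF c]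
    define y where "y t = ?\<sigma> (\<tau> \<eta> \<cdot> c t)" for t
    have y0: "y 0 = \<eta>" using \<eta>(1) \<tau>D(3) by (simp add: y_def cD(1))
    have yd: "(y has_vector_derivative Q \<zeta>) (at 0)" using vel[OF c] by (simp add: y_def[abs_def])
    \<comment> \<open>The relation \<tau>(-y) = \<tau>(y)^{-1} requires y and -y to lie in D;
      continuity secures the second for small t.\<close>
    have ycont: "isCont y 0" using yd by (rule has_vector_derivative_continuous)
    have "((\<lambda>t. - y t) has_vector_derivative - Q \<zeta>) (at 0)" using yd by (rule has_vector_derivative_minus)
    then have "((\<lambda>t. - y t) has_derivative (\<lambda>h. h *\<^sub>R - Q \<zeta>)) (at 0)"
      by (simp add: has_vector_derivative_def)
    from has_derivative_compose[OF this, of _ ?d] d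
    have 1: "((\<lambda>t. id_coord L (\<tau> (- y t) \<cdot> \<tau> \<eta>)) has_derivative (\<lambda>h. ?d (h *\<^sub>R - Q \<zeta>))) (at 0)"
      by (simp add: y0)
    have "\<forall>\<^sub>F t in at 0. \<tau> \<eta> \<cdot> c t \<in> \<tau> ` D"
      using topological_tendstoD[OF isCont_const_mul(1)[OF cD(3), unfolded isCont_def] \<tau>D(2)] \<eta>(1)
      by (simp add: cD(1))
    moreover have "\<forall>\<^sub>F t in at 0. - y t \<in> D"
      using topological_tendstoD[OF tendsto_minus[OF ycont[unfolded isCont_def]] \<tau>D(1)] \<eta>(2)
      by (simp add: y0)
    ultimately have "\<forall>\<^sub>F t in at 0. id_coord L (\<tau> (- y t) \<cdot> \<tau> \<eta>) = id_coord L (c (- t))"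
    proof eventually_elim
      case (elim t)
      have "y t \<in> D" "\<tau> (y t) = \<tau> \<eta> \<cdot> c t"
        using elim(1) by (simp_all add: y_def inv_into_into f_inv_into_f)
      then show ?case using \<tau>D(6)[of "y t"] elim(2) by (simp add: inv_mul mul_assoc cD(4))
    qed
    from has_derivative_transform_eventually[OF 1 this]
    have "((\<lambda>t. id_coord L (c (- t))) has_derivative (\<lambda>h. ?d (h *\<^sub>R - Q \<zeta>))) (at 0)"
      using \<tau>D(6)[OF \<eta>] by (simp add: y0 cD(1))
    then have "((\<lambda>t. id_coord L (c (- t))) has_vector_derivative - ?d (Q \<zeta>)) (at 0)"
      by (simp add: has_vector_derivative_def linear_scale[OF lin] linear_neg[OF lin])
    from vector_derivative_unique_at[OF this one_param_subgroupD(6)[OF one_param_subgroup_uminus[OF c]]]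
    show ?thesis by simp
  qed
  \<comment> \<open>By \<open>dQ\<close> the map ?d is onto, hence injective in finite dimension, so
    \<open>inv ?d\<close> is its true inverse and equals Q.\<close>
  have "inj ?d"
    using linear_surjective_imp_injective[OF lin] dQ by (metis surjI)
  then have inv: "dtau_inv L \<tau> (- \<eta>) = Q"
    unfolding dtau_inv_def using dQ by (metis ext inv_f_f)
  show "((\<lambda>t. ?\<sigma> (\<tau> \<eta> \<cdot> c t)) has_vector_derivative dtau_inv L \<tau> (- \<eta>) \<zeta>) (at 0)"
    if "one_param_subgroup L \<zeta> c"
    using vel[OF that] by (simp add: inv)
  show "linear (dtau_inv L \<tau> (- \<eta>))"
    using has_derivative_linear[OF Q] by (simp add: inv)
qed

end


section \<open>Variations of the discrete path\<close>

context lie_grp begin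

lemma has_left_velocity_const: "has_left_velocity L (\<lambda>\<epsilon>. g) 0"
  by (simp add: has_left_velocity_def)

text \<open>Only the multiplier of step k is varied, along \<omega>. The functional is affine in it
  with slope h\<langle>\<omega>, X k\<rangle>, so criticality makes every \<omega> vanish on X k;
  taking \<omega> = flat (X k) gives X k = 0.\<close>

lemma critical_path_constraint:
  assumes crit: "critical_path L N s (discrete_functional L act lag D \<tau> a b h \<sigma> N s l Nt t T0 I) \<gamma>"
    and h: "h > 0" and k: "k < N"
  shows "inv_into D \<tau> (ginv L (pt_g \<gamma> k) \<cdot> pt_g \<gamma> (Suc k)) = h *\<^sub>R avg_Xi b s \<gamma> (Suc k)"
proof -
  let ?S = "discrete_functional L act lag D \<tau> a b h \<sigma> N s l Nt t T0 I"
  define X where "X k = (1 / h) *\<^sub>R inv_into D \<tau> (ginv L (pt_g \<gamma> k) \<cdot> pt_g \<gamma> (k + 1)) -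
    (\<Sum>i = 1..s. b i *\<^sub>R st_Xi \<gamma> k i)" for k
  define A where "A k = (\<Sum>i = 1..s.
          b i * lag (st_Xi \<gamma> k i, st_V \<gamma> k i)
          + blinfun_apply (st_mu \<gamma> k i)
              ((1 / h) *\<^sub>R inv_into D \<tau> (ginv L (pt_g \<gamma> k) \<cdot> st_G \<gamma> k i)
                - (\<Sum>j = 1..s. a i j *\<^sub>R st_Xi \<gamma> k j))
          + blinfun_apply (st_nu \<gamma> k i)
              ((1 / h) *\<^sub>R (st_Xi \<gamma> k i - pt_xi \<gamma> k)
                - (\<Sum>j = 1..s. a i j *\<^sub>R st_V \<gamma> k j)))" for k
  define B where "B k = blinfun_apply (pt_nu \<gamma> (k + 1))
           ((1 / h) *\<^sub>R (pt_xi \<gamma> (k + 1) - pt_xi \<gamma> k)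
             - (\<Sum>i = 1..s. b i *\<^sub>R st_V \<gamma> k i))" for k
  define C where "C = 1 / (2 * \<sigma>\<^sup>2) * (\<Sum>i = 1..l. (norm (act (ginv L (pt_g \<gamma> (Nt i))) T0 - I (t i)))\<^sup>2)"
  have S: "?S (\<gamma>\<lparr>pt_mu := M\<rparr>) = h * (\<Sum>k<N. A k + blinfun_apply (M (k + 1)) (X k) + B k) + C" for M
    by (simp add: discrete_functional_def A_def B_def C_def X_def)
  have X0: "blinfun_apply \<omega> (X k) = 0" for \<omega> :: "'e \<Rightarrow>\<^sub>L real"
  proof -
    define M where "M \<epsilon> = (pt_mu \<gamma>)(Suc k := pt_mu \<gamma> (Suc k) + \<epsilon> *\<^sub>R \<omega>)" for \<epsilon>
    define \<Gamma> where "\<Gamma> \<epsilon> = \<gamma>\<lparr>pt_mu := M \<epsilon>\<rparr>" for \<epsilon>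
    have "smooth_on UNIV (\<lambda>\<epsilon>. M \<epsilon> j)" for j
      by (cases "j = Suc k") (simp_all add: M_def smooth_on_affine_curve)
    then have "smooth_path_variation L N s \<Gamma>"
      by (simp add: smooth_path_variation_def \<Gamma>_def smooth_map_on_const)
    moreover have "\<Gamma> 0 = \<gamma>" by (simp add: \<Gamma>_def M_def)
    ultimately have "((\<lambda>\<epsilon>. ?S (\<Gamma> \<epsilon>)) has_real_derivative 0) (at 0)"
      using crit by (auto simp: critical_path_def \<Gamma>_def has_left_velocity_const)
    moreover have "?S (\<Gamma> \<epsilon>) = ?S \<gamma> + \<epsilon> * (h * blinfun_apply \<omega> (X k))" for \<epsilon>
    proof -
      have "(\<Sum>j<N. A j + blinfun_apply (M \<epsilon> (j + 1)) (X j) + B j) =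
          (\<Sum>j<N. (A j + blinfun_apply (pt_mu \<gamma> (j + 1)) (X j) + B j) +
            (if k = j then \<epsilon> * blinfun_apply \<omega> (X j) else 0))"
        by (rule sum.cong) (auto simp: M_def blinfun.add_left blinfun.scaleR_left)
      also have "\<dots> = (\<Sum>j<N. A j + blinfun_apply (pt_mu \<gamma> (j + 1)) (X j) + B j) + \<epsilon> * blinfun_apply \<omega> (X k)"
        using k by (subst sum.distrib) simp
      finally show ?thesis
        using S[of "pt_mu \<gamma>"] S[of "M \<epsilon>"] by (simp add: \<Gamma>_def algebra_simps)
    qed
    moreover have "((\<lambda>\<epsilon>. ?S \<gamma> + \<epsilon> * (h * blinfun_apply \<omega> (X k))) has_real_derivative
        h * blinfun_apply \<omega> (X k)) (at 0)"
      by (auto intro!: derivative_eq_intros)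
    ultimately show ?thesis using DERIV_unique h by fastforce
  qed
  from X0[of "flat (X k)"] have "X k = 0" by (simp add: blinfun_apply_flat)
  then have "(1 / h) *\<^sub>R inv_into D \<tau> (ginv L (pt_g \<gamma> k) \<cdot> pt_g \<gamma> (Suc k)) = avg_Xi b s \<gamma> (Suc k)"
    by (simp add: X_def avg_Xi_def)
  then have "h *\<^sub>R ((1 / h) *\<^sub>R inv_into D \<tau> (ginv L (pt_g \<gamma> k) \<cdot> pt_g \<gamma> (Suc k))) = h *\<^sub>R avg_Xi b s \<gamma> (Suc k)"
    by simp
  then show ?thesis using h by simp
qed

text \<open>One identity contains both claims of the theorem: the conditional sum collects the
  target terms at g_m, if there are any.\<close>

lemma discrete_momentum_balance:
  assumes rep: "left_representation L act" and h: "h > 0"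
    and \<tau>: "exp_approx L D \<tau>" and dom: "in_domain L D \<tau> b h N s \<gamma>"
    and crit: "critical_path L N s (discrete_functional L act lag D \<tau> a b h \<sigma> N s l Nt t T0 I) \<gamma>"
    and m: "1 \<le> m" "m < N"
  shows "blinfun_apply (discrete_momentum L \<tau> b h s \<gamma> (m + 1)) \<zeta> - blinfun_apply (discrete_momentum L \<tau> b h s \<gamma> m) \<zeta> =
    - (1 / \<sigma>\<^sup>2) * (\<Sum>i = 1..l. if Nt i = m then
        blinfun_apply (Ad_star L (ginv L (pt_g \<gamma> (Nt i)))
          (diamond L act (act (ginv L (pt_g \<gamma> (Nt i))) T0) (flat (act (ginv L (pt_g \<gamma> (Nt i))) T0 - I (t i))))) \<zeta>
      else 0)"
proof -
  let ?S = "discrete_functional L act lag D \<tau> a b h \<sigma> N s l Nt t T0 I"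
  let ?J = "\<lambda>k. blinfun_apply (discrete_momentum L \<tau> b h s \<gamma> k) \<zeta>"
  let ?g = "pt_g \<gamma>"
  \<comment> \<open>Step k carries the average and the multiplier of index k + 1, hence the
    shift.\<close>
  define \<eta> where "\<eta> k = h *\<^sub>R avg_Xi b s \<gamma> (Suc k)" for k
  have incr: "inv_into D \<tau> (ginv L (?g k) \<cdot> ?g (Suc k)) = \<eta> k" if "k < N" for k
    unfolding \<eta>_def by (rule critical_path_constraint[OF crit h that])
  have incr_dom: "ginv L (?g k) \<cdot> ?g (Suc k) \<in> \<tau> ` D" if "k < N" for k
    using dom that by (simp add: in_domain_def)
  have \<eta>_dom: "\<eta> k \<in> D" "- \<eta> k \<in> D" and \<tau>_\<eta>: "\<tau> (\<eta> k) = ginv L (?g k) \<cdot> ?g (Suc k)" if "k < N" for k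
  proof -
    show "\<eta> k \<in> D" "\<tau> (\<eta> k) = ginv L (?g k) \<cdot> ?g (Suc k)"
      unfolding incr[OF that, symmetric] using incr_dom[OF that] by (auto intro: inv_into_into f_inv_into_f)
    show "- \<eta> k \<in> D" using dom that by (simp add: in_domain_def \<eta>_def)
  qed
  \<comment> \<open>Unfolding the two dual maps gives the number that a right factor with velocity
    Ad \<zeta> at step k will produce.\<close>
  have J: "?J (Suc k) = blinfun_apply (pt_mu \<gamma> (Suc k)) (dtau_inv L \<tau> (- \<eta> k) (Ad L (ginv L (?g (Suc k))) \<zeta>))"
    if "k < N" for k
    using linear_dtau_inv[OF \<tau> \<eta>_dom[OF that]]
    by (simp add: discrete_momentum_def Ad_star_def discrete_mu_def linear_Ad blinfun_apply_dual_map \<eta>_def)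
  obtain c where c: "one_param_subgroup L \<zeta> c" using ex_one_param_subgroup by blast
  note cD = one_param_subgroupD[OF c]
  define g where "g \<epsilon> = ?g(m := c \<epsilon> \<cdot> ?g m)" for \<epsilon>
  define \<Gamma> where "\<Gamma> \<epsilon> = \<gamma>\<lparr>pt_g := g \<epsilon>, st_G := (st_G \<gamma>)(m := \<lambda>i. c \<epsilon> \<cdot> st_G \<gamma> m i)\<rparr>" for \<epsilon>
  have "smooth_map_on UNIV vector_atlas (gatlas L) (\<lambda>\<epsilon>. pt_g (\<Gamma> \<epsilon>) k)" for k
    by (cases "k = m") (simp_all add: \<Gamma>_def g_def smooth_map_on_const smooth_const_mul(2)[OF cont_atlas_vector cD(5)])
  moreover have "smooth_map_on UNIV vector_atlas (gatlas L) (\<lambda>\<epsilon>. st_G (\<Gamma> \<epsilon>) k i)" for k i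
    by (cases "k = m") (simp_all add: \<Gamma>_def smooth_map_on_const smooth_const_mul(2)[OF cont_atlas_vector cD(5)])
  ultimately have "smooth_path_variation L N s \<Gamma>"
    by (simp add: smooth_path_variation_def) (simp add: \<Gamma>_def)
  moreover have "\<Gamma> 0 = \<gamma>" by (simp add: \<Gamma>_def g_def cD(1))
  ultimately have crit0: "((\<lambda>\<epsilon>. ?S (\<Gamma> \<epsilon>)) has_real_derivative 0) (at 0)"
    using crit m(1) by (auto simp: critical_path_def \<Gamma>_def g_def has_left_velocity_const)

  define y where "y k \<epsilon> = inv_into D \<tau> (ginv L (g \<epsilon> k) \<cdot> g \<epsilon> (k + 1))" for k \<epsilon>
  define y' where "y' k = (if k + 1 = m then dtau_inv L \<tau> (- \<eta> k) (Ad L (ginv L (?g (Suc k))) \<zeta>)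
    else if k = m then - dtau_inv L \<tau> (- \<eta> k) (Ad L (ginv L (?g (Suc k))) \<zeta>) else 0)" for k
  have y': "(y k has_vector_derivative y' k) (at 0)" if k: "k < N" for k
  proof -
    consider "k + 1 = m" | "k = m" | "k + 1 \<noteq> m" "k \<noteq> m" by blast
    then show ?thesis
    proof cases
      case 1
      \<comment> \<open>Increment that ends at g_m: g_k^{-1} c g_m = (g_k^{-1} g_m)(g_m^{-1} c
        g_m).\<close>
      have "y k = (\<lambda>\<epsilon>. inv_into D \<tau> (\<tau> (\<eta> k) \<cdot> (ginv L (?g (Suc k)) \<cdot> c \<epsilon> \<cdot> ginv L (ginv L (?g (Suc k))))))"
        using 1 by (simp add: y_def[abs_def] g_def \<tau>_\<eta>[OF k] mul_assoc)
      then show ?thesis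
        using retraction_inv_velocity[OF \<tau> \<eta>_dom[OF k] one_param_subgroup_conj[OF c], of "ginv L (?g (Suc k))"] 1
        by (simp add: y'_def)
    next
      case 2
      \<comment> \<open>Increment that starts at g_m: (c g_m)^{-1} g_{m+1} = (g_m^{-1}
        g_{m+1})(g_{m+1}^{-1} c(-\<epsilon>) g_{m+1}), so the velocity changes sign and the
        conjugating element is g_{m+1}^{-1}.\<close>
      have "y k = (\<lambda>\<epsilon>. inv_into D \<tau> (\<tau> (\<eta> k) \<cdot> (ginv L (?g (Suc k)) \<cdot> c (- \<epsilon>) \<cdot> ginv L (ginv L (?g (Suc k))))))"
        using 2 by (simp add: y_def[abs_def] g_def \<tau>_\<eta>[OF m(2)] mul_assoc inv_mul cD(4))
      then show ?thesis
        using retraction_inv_velocity[OF \<tau> \<eta>_dom[OF k] one_param_subgroup_conj[OF one_param_subgroup_uminus[OF c]],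
            of "ginv L (?g (Suc k))"] 2
        by (simp add: y'_def linear_neg[OF linear_Ad] linear_neg[OF linear_dtau_inv[OF \<tau> \<eta>_dom[OF m(2)]]])
    next
      case 3
      then have "y k = (\<lambda>\<epsilon>. \<eta> k)"
        using incr[OF k] by (simp add: y_def[abs_def] g_def fun_eq_iff)
      then show ?thesis using 3 by (simp add: y'_def)
    qed
  qed

  define f where "f i \<epsilon> = act (ginv L (g \<epsilon> (Nt i))) T0 - I (t i)" for i \<epsilon>
  define f' where "f' i = (if Nt i = m
    then - inf_generator L act (Ad L (ginv L (?g (Nt i))) \<zeta>) (act (ginv L (?g (Nt i))) T0) else 0)" for i
  have f': "(f i has_vector_derivative f' i) (at 0)" for i
  proof (cases "Nt i = m")
    case True
    have act_mul: "act (x \<cdot> z) v = act x (act z v)" for x z v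
      using rep by (simp add: left_representation_def)
    \<comment> \<open>(c g_m)^{-1} T0 is rewritten as a conjugate of c(-\<epsilon>) acting on
      g_m^{-1} T0, so that the generator is taken at g_m^{-1} T0.\<close>
    have "f i \<epsilon> = act (ginv L (?g m) \<cdot> c (- \<epsilon>) \<cdot> ginv L (ginv L (?g m))) (act (ginv L (?g m)) T0) - I (t i)" for \<epsilon>
      using True by (simp add: f_def g_def inv_mul cD(4) act_mul[symmetric] mul_assoc)
    then have "f i = (\<lambda>\<epsilon>. act (ginv L (?g m) \<cdot> c (- \<epsilon>) \<cdot> ginv L (ginv L (?g m))) (act (ginv L (?g m)) T0) - I (t i))"
      by blast
    then show ?thesis
      using has_vector_derivative_diff[OF act_one_param_subgroup[OF rep
            one_param_subgroup_conj[OF one_param_subgroup_uminus[OF c]]] has_vector_derivative_const,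
          of "ginv L (?g m)" "act (ginv L (?g m)) T0" "I (t i)"] True
      by (simp add: f'_def linear_neg[OF linear_Ad] linear_neg[OF linear_inf_generator[OF rep]])
  next
    case False
    then have "f i = (\<lambda>\<epsilon>. act (ginv L (?g (Nt i))) T0 - I (t i))"
      by (simp add: f_def[abs_def] g_def)
    then show ?thesis using False by (simp add: f'_def)
  qed
  have f0: "f i 0 = act (ginv L (?g (Nt i))) T0 - I (t i)" for i
    by (simp add: f_def g_def cD(1))
  have f_norm: "((\<lambda>\<epsilon>. (norm (f i \<epsilon>))\<^sup>2) has_real_derivative 2 * (f i 0 \<bullet> f' i)) (at 0)" for i
  proof -
    have d: "(f i has_derivative (\<lambda>u. u *\<^sub>R f' i)) (at 0)"
      using f' by (simp add: has_vector_derivative_def)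
    show ?thesis
      unfolding has_field_derivative_def power2_norm_eq_inner
      by (rule has_derivative_eq_rhs[OF has_derivative_inner[OF d d]])
        (simp add: fun_eq_iff inner_commute[of "f' i"])
  qed

  \<comment> \<open>\<open>A\<close> and \<open>B\<close> collect the terms that stay constant along
    the variation.\<close>
  define A where "A k = (\<Sum>i = 1..s.
          b i * lag (st_Xi \<gamma> k i, st_V \<gamma> k i)
          + blinfun_apply (st_mu \<gamma> k i)
              ((1 / h) *\<^sub>R inv_into D \<tau> (ginv L (?g k) \<cdot> st_G \<gamma> k i)
                - (\<Sum>j = 1..s. a i j *\<^sub>R st_Xi \<gamma> k j))
          + blinfun_apply (st_nu \<gamma> k i)
              ((1 / h) *\<^sub>R (st_Xi \<gamma> k i - pt_xi \<gamma> k)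
                - (\<Sum>j = 1..s. a i j *\<^sub>R st_V \<gamma> k j)))" for k
  define B where "B k = blinfun_apply (pt_nu \<gamma> (k + 1))
           ((1 / h) *\<^sub>R (pt_xi \<gamma> (k + 1) - pt_xi \<gamma> k)
             - (\<Sum>i = 1..s. b i *\<^sub>R st_V \<gamma> k i))" for k
  define w where "w k = (\<Sum>i = 1..s. b i *\<^sub>R st_Xi \<gamma> k i)" for k
  \<comment> \<open>At k = m the factors c(\<epsilon>) of g_m and of the stage cancel; this is why
    the stages are moved along.\<close>
  have stage: "ginv L (pt_g (\<Gamma> \<epsilon>) k) \<cdot> st_G (\<Gamma> \<epsilon>) k i = ginv L (?g k) \<cdot> st_G \<gamma> k i" for \<epsilon> k i
    by (simp add: \<Gamma>_def g_def inv_mul mul_assoc)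
  have comp: "pt_g (\<Gamma> \<epsilon>) = g \<epsilon>" "pt_xi (\<Gamma> \<epsilon>) = pt_xi \<gamma>" "pt_mu (\<Gamma> \<epsilon>) = pt_mu \<gamma>" "pt_nu (\<Gamma> \<epsilon>) = pt_nu \<gamma>"
    "st_Xi (\<Gamma> \<epsilon>) = st_Xi \<gamma>" "st_V (\<Gamma> \<epsilon>) = st_V \<gamma>" "st_mu (\<Gamma> \<epsilon>) = st_mu \<gamma>" "st_nu (\<Gamma> \<epsilon>) = st_nu \<gamma>" for \<epsilon>
    by (simp_all add: \<Gamma>_def)
  have S: "?S (\<Gamma> \<epsilon>) = h * (\<Sum>k<N. A k + blinfun_apply (pt_mu \<gamma> (k + 1)) ((1 / h) *\<^sub>R y k \<epsilon> - w k) + B k)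
      + 1 / (2 * \<sigma>\<^sup>2) * (\<Sum>i = 1..l. (norm (f i \<epsilon>))\<^sup>2)" for \<epsilon>
    unfolding discrete_functional_def stage unfolding comp A_def B_def w_def y_def f_def by (rule refl)
  have mu': "((\<lambda>\<epsilon>. A k + blinfun_apply (pt_mu \<gamma> (k + 1)) ((1 / h) *\<^sub>R y k \<epsilon> - w k) + B k) has_real_derivative
      blinfun_apply (pt_mu \<gamma> (k + 1)) (y' k) / h) (at 0)" if "k < N" for k
  proof -
    have "((\<lambda>\<epsilon>. (1 / h) *\<^sub>R y k \<epsilon> - w k) has_vector_derivative (1 / h) *\<^sub>R y' k) (at 0)"
      using has_vector_derivative_diff[OF bounded_linear.has_vector_derivative[OF
            bounded_linear_scaleR_right y'[OF that], of "1 / h"] has_vector_derivative_const, of "w k"]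
      by simp
    from bounded_linear.has_vector_derivative[OF blinfun.bounded_linear_right this, of "pt_mu \<gamma> (k + 1)"]
    have "((\<lambda>\<epsilon>. blinfun_apply (pt_mu \<gamma> (k + 1)) ((1 / h) *\<^sub>R y k \<epsilon> - w k)) has_real_derivative
        blinfun_apply (pt_mu \<gamma> (k + 1)) (y' k) / h) (at 0)"
      by (simp add: has_real_derivative_iff_has_vector_derivative blinfun.scaleR_right)
    then show ?thesis by (auto intro!: derivative_eq_intros)
  qed
  have "((\<lambda>\<epsilon>. ?S (\<Gamma> \<epsilon>)) has_real_derivative
      h * (\<Sum>k<N. blinfun_apply (pt_mu \<gamma> (k + 1)) (y' k) / h) + 1 / (2 * \<sigma>\<^sup>2) * (\<Sum>i = 1..l. 2 * (f i 0 \<bullet> f' i))) (at 0)"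
    unfolding S using mu' f_norm by (intro DERIV_add DERIV_cmult DERIV_sum) auto
  from DERIV_unique[OF this crit0]
  \<comment> \<open>The outer h cancels 1/h, and the 2 from the squared norm cancels the one in
    1/(2\<sigma>\<open>\<^sup>2\<close>).\<close>
  have "(\<Sum>k<N. blinfun_apply (pt_mu \<gamma> (k + 1)) (y' k)) + 1 / \<sigma>\<^sup>2 * (\<Sum>i = 1..l. f i 0 \<bullet> f' i) = 0"
    using h by (simp add: sum_divide_distrib[symmetric] sum_distrib_left[symmetric])
  moreover have "(\<Sum>k<N. blinfun_apply (pt_mu \<gamma> (k + 1)) (y' k)) = ?J m - ?J (m + 1)"
  proof -
    \<comment> \<open>Only steps m - 1 and m involve g_m; as m \<ge> 1, the truncated difference is
      the true predecessor.\<close>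
    have "(\<Sum>k<N. blinfun_apply (pt_mu \<gamma> (k + 1)) (y' k)) =
        (\<Sum>k<N. (if k = m - 1 then ?J m else 0) - (if k = m then ?J (m + 1) else 0))"
    proof (rule sum.cong)
      fix k assume "k \<in> {..<N}"
      then show "blinfun_apply (pt_mu \<gamma> (k + 1)) (y' k) =
          (if k = m - 1 then ?J m else 0) - (if k = m then ?J (m + 1) else 0)"
        using J[of k] m(1) by (auto simp: y'_def blinfun.minus_right)
    qed simp
    also have "\<dots> = ?J m - ?J (m + 1)" using m by (simp add: sum_subtractf less_imp_diff_less)
    finally show ?thesis .
  qed
  moreover have "f i 0 \<bullet> f' i = - (if Nt i = m then
        blinfun_apply (Ad_star L (ginv L (?g (Nt i)))
          (diamond L act (act (ginv L (?g (Nt i))) T0) (flat (act (ginv L (?g (Nt i))) T0 - I (t i))))) \<zeta>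
      else 0)" for i
    by (simp add: f0 f'_def Ad_star_def blinfun_apply_dual_map linear_Ad blinfun_apply_diamond[OF rep] blinfun_apply_flat)
  ultimately show ?thesis by (simp add: sum_negf)
qed

end

theorem mainTheorem7:
  fixes L :: "('g::{t2_space, second_countable_topology}, 'e::euclidean_space) lie_data"
    and act :: "'g \<Rightarrow> 'v::real_inner \<Rightarrow> 'v"
    and lag :: "'e \<times> 'e \<Rightarrow> real"
    and D :: "'e set" and \<tau> :: "'e \<Rightarrow> 'g"
    and a :: "nat \<Rightarrow> nat \<Rightarrow> real" and b :: "nat \<Rightarrow> real"
    and h \<sigma> :: real and N s l :: nat
    and Nt :: "nat \<Rightarrow> nat" and t :: "nat \<Rightarrow> real"
    and T0 :: 'v and I :: "real \<Rightarrow> 'v" and \<xi>00 :: 'e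
    and \<gamma> :: "('g, 'e) discrete_path"
  assumes "lie_group L"
    and "left_representation L act"
    and "smooth_on UNIV lag"
    and "\<sigma> \<noteq> 0" and "h > 0"
    and "Nt 0 = 0" and "Nt l = N" and "strict_mono_on {0..l} Nt"
    and "\<forall>i\<in>{1..l}. t i = real (Nt i) * h"
    and "exp_approx L D \<tau>"
    and "in_domain L D \<tau> b h N s \<gamma>"
    and "pt_g \<gamma> 0 = gone L" and "pt_xi \<gamma> 0 = \<xi>00"
    and "critical_path L N s (discrete_functional L act lag D \<tau> a b h \<sigma> N s l Nt t T0 I) \<gamma>"
  shows "(\<forall>k\<in>{1..N - 1} - Nt ` {1..l - 1}.
            discrete_momentum L \<tau> b h s \<gamma> (k + 1) = discrete_momentum L \<tau> b h s \<gamma> k) \<and>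
         (\<forall>i\<in>{1..l - 1}.
            discrete_momentum L \<tau> b h s \<gamma> (Nt i + 1) - discrete_momentum L \<tau> b h s \<gamma> (Nt i) =
            - ((1 / \<sigma>\<^sup>2) *\<^sub>R
               Ad_star L (ginv L (pt_g \<gamma> (Nt i)))
                 (diamond L act (act (ginv L (pt_g \<gamma> (Nt i))) T0)
                   (flat (act (ginv L (pt_g \<gamma> (Nt i))) T0 - I (t i))))))"
proof -
  interpret lie_grp L by unfold_locales (rule assms(1))
  note balance = discrete_momentum_balance[OF assms(2,5,10,11,14)]
  show ?thesis
  proof (intro conjI ballI)
    fix k assume k: "k \<in> {1..N - 1} - Nt ` {1..l - 1}"
    \<comment> \<open>The image omits the last target i = l, but Nt l = N exceeds k.\<close>
    have "Nt i \<noteq> k" if "i \<in> {1..l}" for i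
    proof (cases "i = l")
      case True
      then show ?thesis using k assms(7) by auto
    next
      case False
      then have "i \<in> {1..l - 1}" using that by auto
      then show ?thesis using k by blast
    qed
    then have "(\<Sum>i = 1..l. if Nt i = k then
        blinfun_apply (Ad_star L (ginv L (pt_g \<gamma> (Nt i)))
          (diamond L act (act (ginv L (pt_g \<gamma> (Nt i))) T0) (flat (act (ginv L (pt_g \<gamma> (Nt i))) T0 - I (t i))))) \<zeta>
      else 0) = 0" for \<zeta>
      by (intro sum.neutral) auto
    then show "discrete_momentum L \<tau> b h s \<gamma> (k + 1) = discrete_momentum L \<tau> b h s \<gamma> k"
      using balance[of k] k by (intro blinfun_eqI) auto
  next
    fix i assume i: "i \<in> {1..l - 1}"
    \<comment> \<open>Intermediate targets lie strictly between 0 and N, as the balance requires;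
      injectivity of \<open>Nt\<close> then leaves a single summand.\<close>
    have "Nt 0 < Nt i" "Nt i < Nt l"
      using i by (auto intro!: strict_mono_onD[OF assms(8)])
    then have Ni: "1 \<le> Nt i" "Nt i < N" using assms(6,7) by auto
    have inj: "Nt j = Nt i \<longleftrightarrow> j = i" if "j \<in> {1..l}" for j
      using strict_mono_on_imp_inj_on[OF assms(8)] that i by (auto simp: inj_on_def)
    have "(\<Sum>j = 1..l. if Nt j = Nt i then
        blinfun_apply (Ad_star L (ginv L (pt_g \<gamma> (Nt j)))
          (diamond L act (act (ginv L (pt_g \<gamma> (Nt j))) T0) (flat (act (ginv L (pt_g \<gamma> (Nt j))) T0 - I (t j))))) \<zeta>
      else 0) = blinfun_apply (Ad_star L (ginv L (pt_g \<gamma> (Nt i)))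
          (diamond L act (act (ginv L (pt_g \<gamma> (Nt i))) T0) (flat (act (ginv L (pt_g \<gamma> (Nt i))) T0 - I (t i))))) \<zeta>"
      (is "(\<Sum>j = 1..l. if Nt j = Nt i then ?f j else 0) = _") for \<zeta>
    proof -
      have "(\<Sum>j = 1..l. if Nt j = Nt i then ?f j else 0) = (\<Sum>j = 1..l. if j = i then ?f j else 0)"
        by (rule sum.cong) (auto simp: inj)
      also have "\<dots> = ?f i" using i by auto
      finally show ?thesis .
    qed
    then show "discrete_momentum L \<tau> b h s \<gamma> (Nt i + 1) - discrete_momentum L \<tau> b h s \<gamma> (Nt i) =
            - ((1 / \<sigma>\<^sup>2) *\<^sub>R
               Ad_star L (ginv L (pt_g \<gamma> (Nt i)))
                 (diamond L act (act (ginv L (pt_g \<gamma> (Nt i))) T0)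
                   (flat (act (ginv L (pt_g \<gamma> (Nt i))) T0 - I (t i)))))"
      using balance[OF Ni]
      by (intro blinfun_eqI) (simp add: blinfun.diff_left blinfun.minus_left blinfun.scaleR_left)
  qed
qed

end
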